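(* Let $d\ge2$, $1\le p<\infty$, $a_1>a_2\ge a_3\ge\ldots\ge a_d>0$, and let $E^p:=\{z\in\mathbb R^d:\sum_{k=1}^d(|z_k|/a_k)^p\le1\}$. Let $f:E^p\to[0,\infty)$ satisfy $\int_{E^p}f(z)\,\mathrm dz=1$, be continuous at $(-a_1,\mathbf 0)$ and $(a_1,\mathbf 0)$, with $p_\ell:=f(-a_1,\mathbf 0)>0$ and $p_r:=f(a_1,\mathbf 0)>0$. Let $Z_1,Z_2,\ldots$ be i.i.d. with density $f$, for each $n\in\mathbb N$ let $N_n$ be Poisson with mean $n$ and independent of $(Z_i)_{i\ge 1}$, and put $\mathrm{diam}_p(\mathbf Z_n):=\max_{1\le i,j\le N_n}|Z_i-Z_j|_p$ and $M_n^p:=\max_{1\le i,j\le n}|Z_i-Z_j|_p$. Then, as $n\to\infty$, $$n^{\frac p{d+p-1}}\big(2a_1-\mathrm{diam}_p(\mathbf Z_n)\big)\overset{\mathcal D}{\longrightarrow}\min_{i,j\ge1}\Big\{\mathcal X_{i,1}+\mathcal Y_{j,1}-\frac1{p(2a_1)^{p-1}}\big|\widetilde{\mathcal X}_i-\widetilde{\mathcal Y}_j\big|_p^p\Big\},$$ where $\{\mathcal X_i,i\ge1\}$ and $\{\mathcal Y_j,j\ge1\}$ are independent Poisson processes with intensity measures $p_\ell\cdot m_d|_{P^p}$ and $p_r\cdot m_d|_{P^p}$, respectively, and $$P^p:=\Big\{z\in\mathbb R^d:\sum_{k=2}^d\Big(\frac{|z_k|}{a_k}\Big)^p\le\frac{pz_1}{a_1}\Big\}.$$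 The same holds true if $\mathrm{diam}_p(\mathbf Z_n)$ is replaced with $M_n^p$.
   Context: Notation: $|z|_p:=(\sum_k|z_k|^p)^{1/p}$ is the $p$-norm (on $\mathbb R^d$ or $\mathbb R^{d-1}$), $m_d$ Lebesgue measure on $\mathbb R^d$, $\mu|_A(B):=\mu(A\cap B)$, $\widetilde z:=(z_2,\ldots,z_d)$ for $z\in\mathbb R^d$; $\mathcal X_i=(\mathcal X_{i,1},\widetilde{\mathcal X}_i)$, $\mathcal Y_j=(\mathcal Y_{j,1},\widetilde{\mathcal Y}_j)$. A maximum over an empty set is $0$ (immaterial). *)

theory Defs
  imports "HOL-Probability.Probability"
begin

text \<open>
  Vectors in dimension \<open>d = CARD('n)\<close> are indexed by a finite linear order \<open>'n\<close>, whose least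
  element plays the role of the first coordinate. Sequences of points and random vectors indexed
  by \<open>1, 2, \<dots>\<close> in the mathematics are indexed by \<open>0, 1, \<dots>\<close> here.
\<close>

definition coord1 :: "'n::{finite,linorder}" where
  "coord1 = Min UNIV"

text \<open>The \<open>p\<close>-norm of the subvector of \<open>z\<close> with coordinates in \<open>I\<close>; \<open>I = UNIV\<close> gives the \<open>p\<close>-norm
  of \<open>z\<close> itself, and \<open>I = - {coord1}\<close> that of \<open>z\<close> with its first coordinate dropped.\<close>

definition pnorm_on :: "'n set \<Rightarrow> real \<Rightarrow> real ^ 'n \<Rightarrow> real" where
  "pnorm_on I p z = (\<Sum>k\<in>I. \<bar>z $ k\<bar> powr p) powr (1 / p)"

definition ellipsoid :: "real \<Rightarrow> ('n \<Rightarrow> real) \<Rightarrow> (real ^ 'n) set" where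
  "ellipsoid p a = {z. (\<Sum>k\<in>UNIV. (\<bar>z $ k\<bar> / a k) powr p) \<le> 1}"

definition paraboloid :: "real \<Rightarrow> ('n::{finite,linorder} \<Rightarrow> real) \<Rightarrow> (real ^ 'n::{finite,linorder}) set" where
  "paraboloid p a =
    {z. (\<Sum>k\<in>- {coord1}. (\<bar>z $ k\<bar> / a k) powr p) \<le> p * z $ coord1 / a coord1}"

definition pdiam :: "real \<Rightarrow> nat \<Rightarrow> (nat \<Rightarrow> real ^ 'n) \<Rightarrow> real" where
  "pdiam p m z =
    (if m = 0 then 0 else Max {pnorm_on UNIV p (z i - z j) | i j. i < m \<and> j < m})"

text \<open>The random measure \<open>\<Sum>i. \<delta> (X i)\<close> evaluated at \<open>B\<close>, possibly \<open>\<infinity>\<close>; points are counted with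
  multiplicity.\<close>

definition num_points :: "(nat \<Rightarrow> 'w \<Rightarrow> 'a) \<Rightarrow> 'a set \<Rightarrow> 'w \<Rightarrow> ennreal" where
  "num_points X B \<omega> = emeasure (count_space UNIV) {i. X i \<omega> \<in> B}"

text \<open>The points \<open>X i\<close>, in whatever order they are enumerated, form a Poisson process with
  intensity measure \<open>\<mu>\<close>. A Poisson variable of infinite mean is infinite almost surely, hence the
  probability \<open>0\<close> of every finite value; for mean \<open>0\<close> the formula gives the point mass at \<open>0\<close>.
  An infinite sequence of points requires \<open>\<mu>\<close> to be an infinite measure.\<close>

definition (in prob_space) poisson_process :: "'b measure \<Rightarrow> (nat \<Rightarrow> 'a \<Rightarrow> 'b) \<Rightarrow> bool" where
  "poisson_process \<mu> X \<longleftrightarrow>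
    (\<forall>i. X i \<in> M \<rightarrow>\<^sub>M \<mu>) \<and>
    (\<forall>B\<in>sets \<mu>. \<forall>k::nat. \<P>(\<omega> in M. num_points X B \<omega> = of_nat k) =
       (if emeasure \<mu> B = \<infinity> then 0 else exp (- measure \<mu> B) * measure \<mu> B ^ k / fact k)) \<and>
    (\<forall>(m::nat) B. (\<forall>j<m. B j \<in> sets \<mu>) \<and> disjoint_family_on B {..<m} \<longrightarrow>
       indep_vars (\<lambda>_. borel) (\<lambda>j. num_points X (B j)) {..<m})"

text \<open>Independence of the random measures, not of the enumerations of their points.\<close>

definition (in prob_space) indep_processes ::
    "'b measure \<Rightarrow> (nat \<Rightarrow> 'a \<Rightarrow> 'b) \<Rightarrow> 'b measure \<Rightarrow> (nat \<Rightarrow> 'a \<Rightarrow> 'b) \<Rightarrow> bool" where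
  "indep_processes \<mu> X \<nu> Y \<longleftrightarrow>
    indep_var
      (PiM (sets \<mu>) (\<lambda>_. borel)) (\<lambda>\<omega>. \<lambda>B\<in>sets \<mu>. num_points X B \<omega>)
      (PiM (sets \<nu>) (\<lambda>_. borel)) (\<lambda>\<omega>. \<lambda>B\<in>sets \<nu>. num_points Y B \<omega>)"

text \<open>The measure \<open>c \<cdot> m\<^sub>d|\<^sub>A\<close> on the Borel sets.\<close>

definition scaled_lebesgue_on :: "real \<Rightarrow> (real ^ 'n) set \<Rightarrow> (real ^ 'n) measure" where
  "scaled_lebesgue_on c A = density lborel (\<lambda>z. ennreal c * indicator A z)"

definition limit_value ::
    "real \<Rightarrow> ('n::{finite,linorder} \<Rightarrow> real) \<Rightarrow> real ^ 'n::{finite,linorder} \<Rightarrow> real ^ 'n::{finite,linorder} \<Rightarrow> real" where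
  "limit_value p a x y = x $ coord1 + y $ coord1
    - 1 / (p * (2 * a coord1) powr (p - 1)) * pnorm_on (- {coord1}) p (x - y) powr p"

end

theory Submission
  imports Defs
begin

text \<open>
  Only the void probabilities of the point processes matter. Near a pole the sample is rescaled by
  \<open>s = n powr (- p / (d + p - 1))\<close> in the first coordinate and by \<open>s powr (1 / p)\<close> in the others, so
  that volume is scaled by \<open>1 / n\<close>, the ellipsoid becomes the paraboloid, and the rescaled defect
  \<open>(2 * a coord1 - \<bar>z - w\<bar>) / s\<close> of a pair near opposite poles converges to \<open>limit_value\<close>, uniformly
  on bounded sets. A defect of at most \<open>t\<close> forces both rescaled points into a compact cap of the
  paraboloid. Covering the cap by finitely many small balls sandwiches the event \<open>defect \<le> t\<close>
  between events that depend only on which balls are occupied. By inclusion-exclusion the law of the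
  set of occupied balls is determined by its void probabilities, which are \<open>(1 - q) ^ n\<close> for the
  sample of fixed size, \<open>exp (- n * q)\<close> for the Poissonized one, and both converge to the void
  probabilities of the two limiting Poisson processes.
\<close>

section \<open>Geometry of the ellipsoid\<close>

text \<open>A nearly maximal distance has to force closeness to the poles, linearly in the defect.
  The strict inequality between the first semiaxis and the others enters here as
  \<open>\<kappa> < 1\<close>: in p-th powers, the transversal coordinates recover at most the
  fraction \<open>\<kappa>\<close> of what is lost in the first coordinates. The scaling comes from
  \<open>1 - (1 - v) powr p\<close> being close to \<open>p * v\<close>: at depth of order
  \<open>s\<close> below a pole the p-th powers of the transversal coordinates have order
  \<open>s\<close>, and a slice has volume of order \<open>s powr ((d + p - 1) / p)\<close>.
  Equating this with \<open>1 / n\<close> gives the exponent of the theorem. The coefficient of the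
  transversal term in \<open>limit_value\<close> is the derivative of the p-th root at
  \<open>(2 * a coord1) powr p\<close>. The points of a Poisson process come in an arbitrary
  enumeration, and the minimum runs over infinitely many pairs; events that depend on finitely many
  balls avoid both difficulties, and no convergence of point processes has to be formulated.\<close>

lemma powr_Bernoulli:
  fixes p v :: real
  assumes "1 \<le> p" "0 \<le> v" "v \<le> 1"
  shows "1 - p * v \<le> (1 - v) powr p"
\<comment> \<open>Convexity of powers is used on the positive reals only, so the base
  \<open>1 - v = 0\<close> is settled separately; elsewhere the bound is the tangent at
  \<open>1\<close>.\<close>
proof (cases "v = 1")
  case False
  have "(\<lambda>x. x powr p) (1 - v) - (\<lambda>x. x powr p) 1 \<ge> p * ((1 - v) - 1)"
  proof (rule convex_on_imp_above_tangent[where A = "{0<..}"])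
    show "((\<lambda>x. x powr p) has_field_derivative p) (at 1 within {0<..})"
      using has_real_derivative_powr[of 1 p] by (auto intro: has_field_derivative_at_within)
  qed (use assms False in \<open>auto simp: interior_open intro: powr_convex\<close>)
  then show ?thesis by (simp add: algebra_simps)
qed (use assms in simp)

text \<open>Convexity at the midpoint, multiplied by \<open>2 powr p\<close>. When a summand
  vanishes, \<open>1 \<le> 2 powr (p - 1)\<close> suffices.\<close>

lemma powr_add_le:
  fixes p x y :: real
  assumes "1 \<le> p" "0 \<le> x" "0 \<le> y"
  shows "(x + y) powr p \<le> 2 powr (p - 1) * (x powr p + y powr p)"
proof (cases "x = 0 \<or> y = 0")
  case True
  have "1 \<le> (2::real) powr (p - 1)" using assms by (simp add: ge_one_powr_ge_zero)
  then have "1 * z powr p \<le> 2 powr (p - 1) * z powr p" for z :: real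
    by (intro mult_right_mono) auto
  then show ?thesis using True by auto
next
  case False
  have "((1 - 1/2) *\<^sub>R x + (1/2) *\<^sub>R y) powr p \<le> (1 - 1/2) * x powr p + (1/2) * y powr p"
    using convex_onD[OF powr_convex[OF assms(1)], of "1/2" x y] False assms by auto
  then have "((x + y) / 2) powr p \<le> (x powr p + y powr p) / 2"
    by (simp add: field_simps)
  then have "(x + y) powr p / 2 powr p \<le> (x powr p + y powr p) / 2"
    using assms by (simp add: powr_divide)
  then show ?thesis
    by (simp add: powr_diff field_simps)
qed

lemma powr_nonneg_inverse:
  fixes p x :: real
  assumes "1 \<le> p" "0 \<le> x"
  shows "(x powr p) powr (1 / p) = x" "(x powr (1 / p)) powr p = x"
  using assms by (auto simp: powr_powr)

section \<open>Splitting norms, ellipsoid and paraboloid into the first coordinate and the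
  rest\<close>

locale elliptic_ball =
  fixes p :: real and a :: "'n::{finite,linorder} \<Rightarrow> real"
  assumes p: "1 \<le> p"
    and a_pos: "\<And>k. a k > 0"
    and a_first: "\<And>k. k \<noteq> coord1 \<Longrightarrow> a k < a coord1"
begin

definition tail :: "real ^ 'n::{finite,linorder} \<Rightarrow> real" where
  "tail z = (\<Sum>k\<in>- {coord1}. \<bar>z $ k\<bar> powr p)"

definition wtail :: "real ^ 'n::{finite,linorder} \<Rightarrow> real" where
  "wtail z = (\<Sum>k\<in>- {coord1}. (\<bar>z $ k\<bar> / a k) powr p)"

text \<open>The worst ratio of p-th powers of semiaxes. Inserting \<open>0\<close> keeps the maximum
  meaningful in dimension one, which the locale allows.\<close>

definition \<kappa> :: real where
  "\<kappa> = Max (insert 0 ((\<lambda>k. (a k / a coord1) powr p) ` (- {coord1})))"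

text \<open>The division by \<open>p\<close> is the price of Bernoulli's inequality when a bound on
  the p-th power of a norm is turned into a bound on the norm.\<close>

definition gap :: real where
  "gap = (1 - \<kappa>) / p"

lemma \<kappa>_nonneg: "0 \<le> \<kappa>"
  unfolding \<kappa>_def by (rule Max_ge) auto

lemma \<kappa>_less_1: "\<kappa> < 1"
proof -
  have "(a k / a coord1) powr p < 1" if "k \<noteq> coord1" for k
    using powr_less_mono2[of p "a k / a coord1" 1] a_first[OF that] a_pos[of k] a_pos[of coord1] p
    by auto
  then show ?thesis unfolding \<kappa>_def by (subst Max_less_iff) auto
qed

lemma gap_pos: "0 < gap"
  using \<kappa>_less_1 p by (simp add: gap_def)

lemma tail_nonneg [simp]: "0 \<le> tail z" and wtail_nonneg [simp]: "0 \<le> wtail z"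
  by (auto simp: tail_def wtail_def intro: sum_nonneg)

lemma sum_UNIV_coord1: "(\<Sum>k\<in>UNIV. g k) = g coord1 + (\<Sum>k\<in>- {coord1}. g k)" for g :: "'n \<Rightarrow> real"
  by (subst sum.remove[of _ coord1]) (auto simp: Compl_eq_Diff_UNIV)

lemma pnorm_UNIV: "pnorm_on UNIV p z = (\<bar>z $ coord1\<bar> powr p + tail z) powr (1 / p)"
  by (simp add: pnorm_on_def tail_def sum_UNIV_coord1)

lemma pnorm_tail: "pnorm_on (- {coord1}) p z powr p = tail z"
  using p by (simp add: pnorm_on_def powr_powr flip: tail_def)

lemma mem_ellipsoid:
  "z \<in> ellipsoid p a \<longleftrightarrow> (\<bar>z $ coord1\<bar> / a coord1) powr p + wtail z \<le> 1"
  by (simp add: ellipsoid_def wtail_def sum_UNIV_coord1)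

lemma mem_paraboloid: "z \<in> paraboloid p a \<longleftrightarrow> wtail z \<le> p * z $ coord1 / a coord1"
  by (simp add: paraboloid_def wtail_def)

lemma tail_le_wtail: "tail z \<le> a coord1 powr p * \<kappa> * wtail z"
proof -
  have "\<bar>z $ k\<bar> powr p \<le> a coord1 powr p * \<kappa> * (\<bar>z $ k\<bar> / a k) powr p" if "k \<noteq> coord1" for k
  proof -
    have "\<bar>z $ k\<bar> powr p = a coord1 powr p * (a k / a coord1) powr p * (\<bar>z $ k\<bar> / a k) powr p"
      using a_pos[of k] a_pos[of coord1] by (simp add: powr_divide)
    also have "(a k / a coord1) powr p \<le> \<kappa>"
      unfolding \<kappa>_def using that by (intro Max_ge) auto
    finally show ?thesis by (simp add: mult_left_mono mult_right_mono)
  qed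
  then show ?thesis
    unfolding tail_def wtail_def sum_distrib_left by (intro sum_mono) auto
qed

lemma tail_diff: "tail (x - y) \<le> 2 powr (p - 1) * (tail x + tail y)"
proof -
  have "\<bar>x $ k - y $ k\<bar> powr p \<le> 2 powr (p - 1) * (\<bar>x $ k\<bar> powr p + \<bar>y $ k\<bar> powr p)" for k
    by (rule order_trans[OF _ powr_add_le[OF p]]) (use p in \<open>auto intro!: powr_mono2\<close>)
  then show ?thesis
    by (simp add: tail_def sum_distrib_left sum.distrib[symmetric] sum_mono)
qed

lemma limit_value_eq:
  "limit_value p a x y = x $ coord1 + y $ coord1
     - 1 / (p * (2 * a coord1) powr (p - 1)) * tail (x - y)"
  by (simp add: limit_value_def pnorm_tail)

lemma paraboloid_coord1_nonneg: "z \<in> paraboloid p a \<Longrightarrow> 0 \<le> z $ coord1"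
proof -
  assume "z \<in> paraboloid p a"
  then have "0 \<le> p * z $ coord1 / a coord1"
    using order_trans[OF wtail_nonneg] by (simp add: mem_paraboloid)
  then show ?thesis using p a_pos[of coord1] by (simp add: zero_le_divide_iff zero_le_mult_iff)
qed

text \<open>Coercivity of the limit functional: the factor \<open>2 powr (p - 1)\<close> from
  \<open>tail_diff\<close> cancels against \<open>(2 * a coord1) powr (p - 1)\<close>, and the
  paraboloid bounds \<open>wtail\<close>, so the negative term consumes only the fraction
  \<open>\<kappa>\<close> of the depths. Hence a bounded value confines both points to a compact
  cap.\<close>

lemma limit_value_ge:
  assumes "x \<in> paraboloid p a" "y \<in> paraboloid p a"
  shows "gap * (x $ coord1 + y $ coord1) \<le> limit_value p a x y"
proof -
  let ?A = "a coord1" and ?c = "1 / (p * (2 * a coord1) powr (p - 1))"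
  have A: "?A > 0" by (rule a_pos)
  have c: "0 \<le> ?c" using p by simp
  have "tail (x - y) \<le> 2 powr (p - 1) * (tail x + tail y)" by (rule tail_diff)
  also have "\<dots> \<le> 2 powr (p - 1) * (?A powr p * \<kappa> * wtail x + ?A powr p * \<kappa> * wtail y)"
    by (intro mult_left_mono add_mono tail_le_wtail) auto
  also have "\<dots> = 2 powr (p - 1) * ?A powr p * \<kappa> * (wtail x + wtail y)"
    by (simp add: algebra_simps)
  also have "\<dots> \<le> 2 powr (p - 1) * ?A powr p * \<kappa> * (p * (x $ coord1 + y $ coord1) / ?A)"
    using assms \<kappa>_nonneg
    by (intro mult_left_mono) (auto simp: mem_paraboloid ring_distribs add_divide_distrib)
  finally have "?c * tail (x - y) \<le>
      ?c * (2 powr (p - 1) * ?A powr p * \<kappa> * (p * (x $ coord1 + y $ coord1) / ?A))"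
    using c by (intro mult_left_mono) auto
  also have "\<dots> = \<kappa> * (x $ coord1 + y $ coord1)"
    using A p by (simp add: powr_mult powr_diff divide_simps)
  finally have "limit_value p a x y \<ge> (1 - \<kappa>) * (x $ coord1 + y $ coord1)"
    by (simp add: limit_value_eq algebra_simps)
  \<comment> \<open>The weaker constant \<open>gap\<close> is used so that one cap serves both the
    limit and the finite samples.\<close>
  moreover have "gap \<le> 1 - \<kappa>"
    using p \<kappa>_less_1 by (simp add: gap_def divide_le_eq mult_left_mono[of 1 p "1 - \<kappa>", simplified])
  then have "gap * (x $ coord1 + y $ coord1) \<le> (1 - \<kappa>) * (x $ coord1 + y $ coord1)"
    using assms by (intro mult_right_mono add_nonneg_nonneg paraboloid_coord1_nonneg)
  ultimately show ?thesis by linarith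
qed

lemma ellipsoid_coord1: "z \<in> ellipsoid p a \<Longrightarrow> \<bar>z $ coord1\<bar> \<le> a coord1"
proof -
  assume "z \<in> ellipsoid p a"
  then have "(\<bar>z $ coord1\<bar> / a coord1) powr p \<le> 1 powr p"
    using wtail_nonneg[of z] by (simp add: mem_ellipsoid del: wtail_nonneg)
  then have "\<bar>z $ coord1\<bar> / a coord1 \<le> 1"
    using p a_pos[of coord1] powr_less_mono2[of p 1 "\<bar>z $ coord1\<bar> / a coord1"] by fastforce
  then show ?thesis using a_pos[of coord1] by simp
qed

lemma tail_diff_ellipsoid:
  assumes "z \<in> ellipsoid p a" "w \<in> ellipsoid p a"
  shows "tail (z - w) \<le> 2 powr (p - 1) * a coord1 powr p * \<kappa> *
    (2 - (\<bar>z $ coord1\<bar> / a coord1) powr p - (\<bar>w $ coord1\<bar> / a coord1) powr p)"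
proof -
  let ?A = "a coord1"
  have "tail (z - w) \<le> 2 powr (p - 1) * (tail z + tail w)" by (rule tail_diff)
  also have "\<dots> \<le> 2 powr (p - 1) * (?A powr p * \<kappa> * wtail z + ?A powr p * \<kappa> * wtail w)"
    by (intro mult_left_mono add_mono tail_le_wtail) auto
  also have "\<dots> = 2 powr (p - 1) * ?A powr p * \<kappa> * (wtail z + wtail w)"
    by (simp add: algebra_simps)
  also have "\<dots> \<le> 2 powr (p - 1) * ?A powr p * \<kappa> *
     (2 - (\<bar>z $ coord1\<bar> / ?A) powr p - (\<bar>w $ coord1\<bar> / ?A) powr p)"
    using assms \<kappa>_nonneg by (intro mult_left_mono) (auto simp: mem_ellipsoid)
  finally show ?thesis .
qed

text \<open>Minkowski's inequality is avoided: termwise convexity of \<open>\<lambda>x. x powr p\<close> costs a factor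
  \<open>2 powr (p - 1)\<close>, which is exactly what is available as \<open>z\<close> and \<open>w\<close> both have \<open>p\<close>-norm at most
  \<open>a coord1\<close>.\<close>

lemma pnorm_diff_le:
  assumes "z \<in> ellipsoid p a" "w \<in> ellipsoid p a"
  shows "gap * ((a coord1 - \<bar>z $ coord1\<bar>) + (a coord1 - \<bar>w $ coord1\<bar>))
    \<le> 2 * a coord1 - pnorm_on UNIV p (z - w)"
proof -
  let ?A = "a coord1"
  define r s where "r = \<bar>z $ coord1\<bar> / ?A" and "s = \<bar>w $ coord1\<bar> / ?A"
  have A: "?A > 0" by (rule a_pos)
  have r: "0 \<le> r" "r \<le> 1" and s: "0 \<le> s" "s \<le> 1"
    using ellipsoid_coord1[OF assms(1)] ellipsoid_coord1[OF assms(2)] A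
    by (auto simp: r_def s_def)
  have q: "x powr p \<le> x" if "0 \<le> x" "x \<le> 1" for x :: real
    using powr_mono'[of 1 p x] that p by auto
  \<comment> \<open>Chosen so that \<open>2 * (1 - p * v)\<close> equals the bracket
    \<open>2 * \<kappa> + (1 - \<kappa>) * (r + s)\<close> that arises below; Bernoulli's inequality
    then produces a p-th power.\<close>
  define v where "v = (1 - \<kappa>) / (2 * p) * ((1 - r) + (1 - s))"
  have v: "0 \<le> v" "v \<le> 1"
  proof -
    show "0 \<le> v" using r s p \<kappa>_less_1 by (simp add: v_def)
    have "(1 - \<kappa>) * ((1 - r) + (1 - s)) \<le> 1 * 2"
      using r s \<kappa>_less_1 \<kappa>_nonneg by (intro mult_mono) auto
    then show "v \<le> 1" using p by (simp add: v_def divide_le_eq)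
  qed
  have "\<bar>z $ coord1 - w $ coord1\<bar> powr p \<le> 2 powr (p - 1) * (\<bar>z $ coord1\<bar> powr p + \<bar>w $ coord1\<bar> powr p)"
    by (rule order_trans[OF _ powr_add_le[OF p]]) (use p in \<open>auto intro!: powr_mono2\<close>)
  also have "\<dots> = 2 powr (p - 1) * ?A powr p * (r powr p + s powr p)"
    using A by (simp add: r_def s_def powr_divide field_simps)
  finally have "\<bar>z $ coord1 - w $ coord1\<bar> powr p + tail (z - w)
     \<le> 2 powr (p - 1) * ?A powr p * (r powr p + s powr p)
       + 2 powr (p - 1) * ?A powr p * \<kappa> * (2 - r powr p - s powr p)"
    using tail_diff_ellipsoid[OF assms] by (simp add: r_def s_def)
  also have "\<dots> = 2 powr (p - 1) * ?A powr p * (2 * \<kappa> + (1 - \<kappa>) * (r powr p + s powr p))"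
    by (simp add: algebra_simps)
  also have "\<dots> \<le> 2 powr (p - 1) * ?A powr p * (2 * \<kappa> + (1 - \<kappa>) * (r + s))"
    using \<kappa>_less_1 r s by (intro mult_left_mono add_mono q) auto
  also have "\<dots> = (2 * ?A) powr p * (1 - p * v)"
    using A p by (simp add: v_def powr_mult powr_diff field_simps)
  also have "\<dots> \<le> (2 * ?A) powr p * (1 - v) powr p"
    using v p by (intro mult_left_mono powr_Bernoulli) auto
  also have "\<dots> = (2 * ?A * (1 - v)) powr p"
    using v A by (simp add: powr_mult)
  finally have "\<bar>z $ coord1 - w $ coord1\<bar> powr p + tail (z - w) \<le> (2 * ?A * (1 - v)) powr p" .
  then have "pnorm_on UNIV p (z - w) \<le> ((2 * ?A * (1 - v)) powr p) powr (1 / p)"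
    unfolding pnorm_UNIV using p by (intro powr_mono2) auto
  also have "\<dots> = 2 * ?A * (1 - v)"
    using v A p by (intro powr_nonneg_inverse) auto
  finally have "pnorm_on UNIV p (z - w) \<le> 2 * ?A - 2 * ?A * v" by (simp add: algebra_simps)
  moreover have "2 * ?A * v = gap * ((?A - \<bar>z $ coord1\<bar>) + (?A - \<bar>w $ coord1\<bar>))"
    using A p by (simp add: v_def gap_def r_def s_def field_simps)
  ultimately show ?thesis by linarith
qed

text \<open>When the first coordinates do not have opposite signs, their difference is at most the
  larger modulus, so a single \<open>m powr p\<close> remains where two terms could occur. Even for
  \<open>m = 1\<close> the bracket is \<open>1 + \<kappa> < 2\<close>, so such pairs stay a fixed
  amount below the maximal distance.\<close>

lemma pnorm_diff_same_side:
  assumes "z \<in> ellipsoid p a" "w \<in> ellipsoid p a" "0 \<le> (z $ coord1) * (w $ coord1)"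
  shows "pnorm_on UNIV p (z - w) \<le> 2 * a coord1 * ((1 + \<kappa>) / 2) powr (1 / p)"
proof -
  let ?A = "a coord1"
  define r s where "r = \<bar>z $ coord1\<bar> / ?A" and "s = \<bar>w $ coord1\<bar> / ?A"
  have A: "?A > 0" by (rule a_pos)
  have r: "0 \<le> r" "r \<le> 1" and s: "0 \<le> s" "s \<le> 1"
    using ellipsoid_coord1[OF assms(1)] ellipsoid_coord1[OF assms(2)] A
    by (auto simp: r_def s_def)
  define m where "m = max r s"
  have m: "0 \<le> m" "m \<le> 1" using r s by (auto simp: m_def)
  have two: "1 \<le> (2::real) powr (p - 1)" using p by (simp add: ge_one_powr_ge_zero)
  have mp: "m powr p \<le> 1" using m p powr_mono2[of p m 1] by auto
  have "\<bar>z $ coord1 - w $ coord1\<bar> \<le> max \<bar>z $ coord1\<bar> \<bar>w $ coord1\<bar>"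
    using assms(3) by (auto simp: zero_le_mult_iff)
  also have "\<dots> = ?A * m"
    using A by (auto simp: m_def r_def s_def max_def divide_simps)
  finally have "\<bar>z $ coord1 - w $ coord1\<bar> powr p \<le> (?A * m) powr p"
    using p by (intro powr_mono2) auto
  also have "\<dots> = 1 * (?A powr p * m powr p)" using A m by (simp add: powr_mult)
  \<comment> \<open>Inserting this factor gives the first coordinate and the transversal term a
    common prefactor.\<close>
  also have "\<dots> \<le> 2 powr (p - 1) * (?A powr p * m powr p)"
    using two by (intro mult_right_mono) auto
  finally have "\<bar>z $ coord1 - w $ coord1\<bar> powr p + tail (z - w)
     \<le> 2 powr (p - 1) * (?A powr p * m powr p)
       + 2 powr (p - 1) * ?A powr p * \<kappa> * (2 - r powr p - s powr p)"
    using tail_diff_ellipsoid[OF assms(1,2)] by (simp add: r_def s_def)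
  also have "\<dots> \<le> 2 powr (p - 1) * (?A powr p * m powr p)
       + 2 powr (p - 1) * ?A powr p * \<kappa> * (2 - m powr p)"
    using \<kappa>_nonneg by (intro add_mono mult_left_mono) (auto simp: m_def max_def)
  also have "\<dots> = 2 powr (p - 1) * ?A powr p * ((1 - \<kappa>) * m powr p + 2 * \<kappa>)"
    by (simp add: algebra_simps)
  also have "\<dots> \<le> 2 powr (p - 1) * ?A powr p * ((1 - \<kappa>) * 1 + 2 * \<kappa>)"
    using \<kappa>_less_1 mp by (intro mult_left_mono add_mono) auto
  also have "\<dots> = (2 * ?A) powr p * ((1 + \<kappa>) / 2)"
    using A by (simp add: powr_mult powr_diff)
  finally have "pnorm_on UNIV p (z - w) \<le> ((2 * ?A) powr p * ((1 + \<kappa>) / 2)) powr (1 / p)"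
    unfolding pnorm_UNIV using p by (intro powr_mono2) auto
  also have "\<dots> = ((2 * ?A) powr p) powr (1 / p) * ((1 + \<kappa>) / 2) powr (1 / p)"
    using \<kappa>_nonneg by (intro powr_mult)
  also have "((2 * ?A) powr p) powr (1 / p) = 2 * ?A"
    using A p by (intro powr_nonneg_inverse) auto
  finally show ?thesis .
qed

end

section \<open>Rescaling at the poles\<close>

text \<open>The first-order expansion of the distance in \<open>s\<close>, with \<open>A\<close> the
  maximal distance, \<open>u\<close> the total depth and \<open>w\<close> the transversal term. The
  sequences \<open>u\<close> and \<open>w\<close> are bounded rather than convergent; this is what
  yields uniformity later.\<close>

lemma root_expansion:
  fixes p A U :: real and s u w :: "nat \<Rightarrow> real"
  assumes p: "1 \<le> p" and A: "0 < A" and s: "s \<longlonglongrightarrow> 0" "\<And>k. 0 < s k"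
    and u: "\<And>k. \<bar>u k\<bar> \<le> U" and w: "\<And>k. \<bar>w k\<bar> \<le> U"
  shows "(\<lambda>k. (A - (\<bar>A - s k * u k\<bar> powr p + s k * w k) powr (1 / p)) / s k
            - (u k - 1 / (p * A powr (p - 1)) * w k)) \<longlonglongrightarrow> 0"
proof -
  have "((\<lambda>v. v powr p) has_real_derivative (p * A powr (p - 1))) (at A)"
    using A by (auto intro!: derivative_eq_intros)
  \<comment> \<open>Caratheodory's form of the derivative factors each increment exactly through a
    slope that is continuous at the base point, so no remainder terms have to be estimated.\<close>
  then obtain g where g: "\<And>v. v powr p - A powr p = g v * (v - A)"
    and g_cont: "isCont g A" and g_A: "g A = p * A powr (p - 1)"
    unfolding CARAT_DERIV by blast
  have "((\<lambda>v. v powr (1 / p)) has_real_derivative (1 / p * (A powr p) powr (1 / p - 1))) (at (A powr p))"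
    using A by (auto intro!: derivative_eq_intros)
  then obtain h where h: "\<And>v. v powr (1 / p) - (A powr p) powr (1 / p) = h v * (v - A powr p)"
    and h_cont: "isCont h (A powr p)" and h_A: "h (A powr p) = 1 / p * (A powr p) powr (1 / p - 1)"
    unfolding CARAT_DERIV by blast
  have Ap: "(A powr p) powr (1 / p) = A" using A p by (simp add: powr_powr)
  have hA: "h (A powr p) = 1 / (p * A powr (p - 1))"
    using A p by (simp add: h_A powr_powr right_diff_distrib powr_diff)
  have bounded_null: "(\<lambda>k. x k * y k) \<longlonglongrightarrow> 0"
    if "x \<longlonglongrightarrow> 0" "\<And>k. \<bar>y k\<bar> \<le> U" for x y :: "nat \<Rightarrow> real"
  proof (rule Lim_null_comparison)
    show "\<forall>\<^sub>F k in sequentially. norm (x k * y k) \<le> \<bar>x k\<bar> * U"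
      using that(2) by (intro always_eventually allI) (simp add: abs_mult mult_left_mono)
    show "(\<lambda>k. \<bar>x k\<bar> * U) \<longlonglongrightarrow> 0"
      using tendsto_mult_right[OF tendsto_rabs[OF that(1)], of U] by simp
  qed
  define v where "v k = A - s k * u k" for k
  define q where "q k = v k powr p + s k * w k" for k
  have v_lim: "v \<longlonglongrightarrow> A"
    unfolding v_def using tendsto_diff[OF tendsto_const bounded_null[OF s(1) u], of A] by simp
  have "q \<longlonglongrightarrow> A powr p + 0"
    unfolding q_def using A by (intro tendsto_add tendsto_powr v_lim bounded_null s(1) w) auto
  then have q_lim: "q \<longlonglongrightarrow> A powr p" by simp
  have g_lim: "(\<lambda>k. g (v k)) \<longlonglongrightarrow> g A" by (rule isCont_tendsto_compose[OF g_cont v_lim])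
  have h_lim: "(\<lambda>k. h (q k)) \<longlonglongrightarrow> h (A powr p)" by (rule isCont_tendsto_compose[OF h_cont q_lim])
  have "(\<lambda>k. (h (q k) * g (v k) - h (A powr p) * g A) * u k
          + (h (A powr p) - h (q k)) * w k) \<longlonglongrightarrow> 0 + 0"
    using tendsto_mult[OF h_lim g_lim] h_lim
    by (intro tendsto_add bounded_null u w) (auto intro: LIM_zero tendsto_eq_intros)
  moreover have "\<forall>\<^sub>F k in sequentially. v k > 0"
    using order_tendstoD(1)[OF v_lim A] .
  then have "\<forall>\<^sub>F k in sequentially. (h (q k) * g (v k) - h (A powr p) * g A) * u k
          + (h (A powr p) - h (q k)) * w k
       = (A - (\<bar>A - s k * u k\<bar> powr p + s k * w k) powr (1 / p)) / s k
            - (u k - 1 / (p * A powr (p - 1)) * w k)"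
  proof eventually_elim
    case (elim k)
    have "q k - A powr p = g (v k) * (v k - A) + s k * w k"
      unfolding q_def g[symmetric] by simp
    then have q_diff: "q k - A powr p = s k * (w k - g (v k) * u k)"
      by (simp add: v_def algebra_simps)
    have "A - q k powr (1 / p) = - (h (q k) * (q k - A powr p))"
      using h[of "q k"] by (simp add: Ap)
    also have "\<dots> = s k * (h (q k) * (g (v k) * u k - w k))"
      unfolding q_diff by (simp add: algebra_simps)
    finally have "A - q k powr (1 / p) = s k * (h (q k) * (g (v k) * u k - w k))" .
    then have "(A - (\<bar>A - s k * u k\<bar> powr p + s k * w k) powr (1 / p)) / s k
        = h (q k) * (g (v k) * u k - w k)"
      using s(2)[of k] elim by (simp add: q_def v_def)
    \<comment> \<open>The p-th power and the p-th root are inverse to each other, so their slopes at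
      the base points are reciprocal and \<open>u\<close> gets the coefficient
      \<open>1\<close>.\<close>
    moreover have hg: "h (A powr p) * g A = 1" using A p by (simp add: hA g_A)
    have "u k - 1 / (p * A powr (p - 1)) * w k = (h (A powr p) * g A) * u k - h (A powr p) * w k"
      unfolding hg by (simp add: hA)
    ultimately show ?case by (simp only:) (simp add: algebra_simps)
  qed
  ultimately show ?thesis by (simp add: tendsto_cong)
qed

context elliptic_ball
begin

text \<open>The sign \<open>\<sigma>\<close> selects the pole \<open>axis coord1 (\<sigma> * a coord1)\<close>.\<close>

definition rescale :: "real \<Rightarrow> real \<Rightarrow> real ^ 'n::{finite,linorder} \<Rightarrow> real ^ 'n::{finite,linorder}" where
  "rescale \<sigma> s z = (\<chi> k. if k = coord1 then (a coord1 - \<sigma> * z $ coord1) / s else z $ k / s powr (1 / p))"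

definition unscale :: "real \<Rightarrow> real \<Rightarrow> real ^ 'n::{finite,linorder} \<Rightarrow> real ^ 'n::{finite,linorder}" where
  "unscale \<sigma> s x = (\<chi> k. if k = coord1 then \<sigma> * (a coord1 - s * x $ coord1) else s powr (1 / p) * x $ k)"

definition pre_value :: "real \<Rightarrow> real ^ 'n::{finite,linorder} \<Rightarrow> real ^ 'n::{finite,linorder} \<Rightarrow> real" where
  "pre_value s x y = (2 * a coord1 - pnorm_on UNIV p (unscale (-1) s x - unscale 1 s y)) / s"

lemma rescale_unscale: "\<sigma> \<in> {-1, 1} \<Longrightarrow> 0 < s \<Longrightarrow> rescale \<sigma> s (unscale \<sigma> s x) = x"
  by (auto simp: rescale_def unscale_def vec_eq_iff)

lemma unscale_rescale: "\<sigma> \<in> {-1, 1} \<Longrightarrow> 0 < s \<Longrightarrow> unscale \<sigma> s (rescale \<sigma> s x) = x"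
  by (auto simp: rescale_def unscale_def vec_eq_iff)

lemma wtail_unscale: "0 < s \<Longrightarrow> wtail (unscale \<sigma> s x) = s * wtail x"
  using p by (auto simp: wtail_def unscale_def sum_distrib_left abs_mult powr_mult powr_powr
      divide_simps powr_divide less_imp_le[OF a_pos] intro!: sum.cong)

text \<open>\<open>wtail\<close> is homogeneous of degree \<open>p\<close>, so transversal scaling
  by \<open>s powr (1 / p)\<close> multiplies it by \<open>s\<close>. The right-hand side is a
  difference quotient whose limit \<open>p * x $ coord1 / a coord1\<close> defines the
  paraboloid.\<close>

lemma unscale_mem_ellipsoid:
  assumes "\<sigma> \<in> {-1, 1}" "0 < s"
  shows "unscale \<sigma> s x \<in> ellipsoid p a \<longleftrightarrow>
    wtail x \<le> (1 - \<bar>1 - s * (x $ coord1 / a coord1)\<bar> powr p) / s"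
proof -
  have "\<bar>unscale \<sigma> s x $ coord1\<bar> / a coord1 = \<bar>1 - s * (x $ coord1 / a coord1)\<bar>"
    using assms(1) a_pos[of coord1] by (auto simp: unscale_def abs_mult divide_simps)
  then show ?thesis
    unfolding mem_ellipsoid wtail_unscale[OF assms(2)]
    using assms(2) by (simp add: field_simps)
qed

text \<open>By Bernoulli's inequality the difference quotient does not exceed its limit, so the
  rescaled half of the ellipsoid lies inside the paraboloid for every \<open>s\<close>, not merely
  asymptotically. The restriction to one half keeps \<open>v\<close> in the unit interval.\<close>

lemma rescale_mem_paraboloid:
  assumes z: "z \<in> ellipsoid p a" "0 \<le> \<sigma> * z $ coord1" and \<sigma>: "\<sigma> \<in> {-1, 1}" and s: "0 < s"
  shows "rescale \<sigma> s z \<in> paraboloid p a"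
proof -
  define x where "x = rescale \<sigma> s z"
  define v where "v = s * (x $ coord1 / a coord1)"
  have v: "v = 1 - \<sigma> * z $ coord1 / a coord1"
    using s a_pos[of coord1] by (simp add: v_def x_def rescale_def divide_simps)
  have "\<bar>\<sigma> * z $ coord1\<bar> \<le> a coord1" using ellipsoid_coord1[OF z(1)] \<sigma> by (auto simp: abs_mult)
  then have v01: "0 \<le> v" "v \<le> 1" using z(2) a_pos[of coord1] by (auto simp: v divide_simps)
  have "unscale \<sigma> s x \<in> ellipsoid p a" unfolding x_def using z(1) unscale_rescale[OF \<sigma> s] by simp
  then have "wtail x \<le> (1 - \<bar>1 - v\<bar> powr p) / s" using unscale_mem_ellipsoid[OF \<sigma> s] by (simp add: v_def)
  also have "\<dots> \<le> (p * v) / s"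
    using powr_Bernoulli[OF p v01] v01 s by (intro divide_right_mono) auto
  also have "\<dots> = p * x $ coord1 / a coord1" using s by (simp add: v_def)
  finally show ?thesis by (simp add: mem_paraboloid x_def)
qed

lemma pre_value_eq:
  assumes "0 < s"
  shows "pre_value s x y = (2 * a coord1 -
    (\<bar>2 * a coord1 - s * (x $ coord1 + y $ coord1)\<bar> powr p + s * tail (x - y)) powr (1 / p)) / s"
proof -
  have "tail (unscale (-1) s x - unscale 1 s y) = s * tail (x - y)"
  proof -
    have "\<bar>s powr (1 / p) * x $ k - s powr (1 / p) * y $ k\<bar> powr p = s * \<bar>x $ k - y $ k\<bar> powr p" for k
    proof -
      have "\<bar>s powr (1 / p) * x $ k - s powr (1 / p) * y $ k\<bar> = s powr (1 / p) * \<bar>x $ k - y $ k\<bar>"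
        by (simp add: abs_mult flip: right_diff_distrib)
      then show ?thesis using p assms by (simp add: powr_mult powr_powr)
    qed
    then show ?thesis by (simp add: tail_def unscale_def sum_distrib_left)
  qed
  moreover have "\<bar>(unscale (-1) s x - unscale 1 s y) $ coord1\<bar> = \<bar>2 * a coord1 - s * (x $ coord1 + y $ coord1)\<bar>"
    by (simp add: unscale_def algebra_simps)
  ultimately show ?thesis by (simp add: pre_value_def pnorm_UNIV)
qed

lemma tail_bounded:
  assumes "norm x \<le> L" "norm y \<le> L"
  shows "tail (x - y) \<le> real (card (- {coord1 :: 'n})) * (2 * L) powr p"
proof -
  have "\<bar>x $ k - y $ k\<bar> powr p \<le> (2 * L) powr p" for k
    using component_le_norm_cart[of x k] component_le_norm_cart[of y k] assms p
    by (intro powr_mono2) auto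
  then have "tail (x - y) \<le> (\<Sum>k\<in>- {coord1 :: 'n}. (2 * L) powr p)"
    unfolding tail_def by (intro sum_mono) auto
  then show ?thesis by simp
qed

text \<open>Failure of uniformity would give points of a ball for parameters tending to
  \<open>0\<close>. Since \<open>root_expansion\<close> asks only for bounds, it applies to them
  without passing to convergent subsequences.\<close>

lemma pre_value_uniform:
  assumes "0 < \<epsilon>"
  shows "\<exists>s0>0. \<forall>s x y. 0 < s \<longrightarrow> s < s0 \<longrightarrow> norm x \<le> L \<longrightarrow> norm y \<le> L \<longrightarrow>
    \<bar>pre_value s x y - limit_value p a x y\<bar> < \<epsilon>"
proof (rule ccontr)
  let ?bad = "\<lambda>s x y. norm x \<le> L \<and> norm y \<le> L \<and> \<not> \<bar>pre_value s x y - limit_value p a x y\<bar> < \<epsilon>"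
  assume *: "\<not> ?thesis"
  have "\<exists>s x y. 0 < s \<and> s < inverse (real (Suc k)) \<and> ?bad s x y" for k
    using * by (metis inverse_positive_iff_positive of_nat_0_less_iff zero_less_Suc)
  then obtain s x y where s: "\<And>k. 0 < s k" "\<And>k. s k < inverse (real (Suc k))"
    and bad: "\<And>k. ?bad (s k) (x k) (y k)" by metis
  define U where "U = max (2 * L) (real (card (- {coord1 :: 'n})) * (2 * L) powr p)"
  have "s \<longlonglongrightarrow> 0"
    by (rule Lim_null_comparison[OF _ LIMSEQ_inverse_real_of_nat])
       (use s in \<open>auto intro!: always_eventually simp: less_imp_le\<close>)
  moreover have "\<bar>x k $ coord1 + y k $ coord1\<bar> \<le> U" for k
    using component_le_norm_cart[of "x k" coord1] component_le_norm_cart[of "y k" coord1] bad[of k]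
    by (auto simp: U_def)
  moreover have "\<bar>tail (x k - y k)\<bar> \<le> U" for k
    using tail_bounded[of "x k" L "y k"] bad[of k] by (auto simp: U_def)
  ultimately have "(\<lambda>k. pre_value (s k) (x k) (y k) - limit_value p a (x k) (y k)) \<longlonglongrightarrow> 0"
    using root_expansion[OF p, of "2 * a coord1" s "\<lambda>k. x k $ coord1 + y k $ coord1" U "\<lambda>k. tail (x k - y k)"]
      a_pos[of coord1] s(1)
    by (simp add: pre_value_eq limit_value_eq)
  from LIMSEQ_D[OF this assms] bad show False by auto
qed

section \<open>Closedness, and the null boundary of the paraboloid\<close>

lemma continuous_wtail: "continuous_on S wtail"
  unfolding wtail_def using p
  by (intro continuous_on_sum continuous_on_powr' continuous_intros) (auto simp: less_imp_le[OF a_pos] less_imp_neq[OF a_pos, symmetric])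

lemma closed_ellipsoid: "closed (ellipsoid p a)"
proof -
  have "ellipsoid p a = {z. (\<bar>z $ coord1\<bar> / a coord1) powr p + wtail z \<le> 1}"
    using mem_ellipsoid by auto
  also have "closed \<dots>"
    using p a_pos[of coord1]
    by (intro closed_Collect_le continuous_wtail continuous_on_add continuous_on_powr' continuous_intros) auto
  finally show ?thesis .
qed

lemma closed_paraboloid: "closed (paraboloid p a)"
proof -
  have "paraboloid p a = {z. wtail z \<le> p * z $ coord1 / a coord1}"
    using mem_paraboloid by auto
  also have "closed \<dots>"
    using a_pos[of coord1] by (intro closed_Collect_le continuous_wtail continuous_intros) auto
  finally show ?thesis .
qed

lemma wtail_add_axis: "wtail (axis coord1 b + c *\<^sub>R x) = \<bar>c\<bar> powr p * wtail x"
  using p by (auto simp: wtail_def sum_distrib_left axis_def abs_mult powr_mult powr_divide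
      less_imp_le[OF a_pos] intro!: sum.cong)

text \<open>Every ray from \<open>axis coord1 1\<close>, a point inside the paraboloid, meets the
  boundary at most once, and a closed set with this property is negligible.\<close>

lemma negligible_paraboloid_boundary: "negligible {x. wtail x = p * x $ coord1 / a coord1}"
proof (rule starlike_negligible[where a = "axis coord1 1"])
  show "closed {x. wtail x = p * x $ coord1 / a coord1}"
    using a_pos[of coord1] by (intro closed_Collect_eq continuous_wtail continuous_intros) auto
next
  fix c x
  assume c: "0 \<le> c" and *: "axis coord1 1 + c *\<^sub>R x \<in> {x. wtail x = p * x $ coord1 / a coord1}"
    "axis coord1 1 + x \<in> {x. wtail x = p * x $ coord1 / a coord1}"
  define \<beta> where "\<beta> = p / a coord1"
  have \<beta>: "\<beta> > 0" using p a_pos[of coord1] by (simp add: \<beta>_def)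
  have 1: "wtail x = \<beta> * (1 + x $ coord1)"
    using *(2) wtail_add_axis[of 1 1 x] by (simp add: \<beta>_def axis_def)
  have "c powr p * wtail x = \<beta> * (1 + c * x $ coord1)"
    using *(1) wtail_add_axis[of 1 c x] c by (simp add: \<beta>_def axis_def)
  \<comment> \<open>Subtracting \<open>c\<close> times the equation \<open>1\<close> removes the
    first coordinate; for \<open>c \<noteq> 1\<close> the two sides have incompatible signs.\<close>
  then have 2: "(c powr p - c) * wtail x = \<beta> * (1 - c)"
    using 1 by (simp add: algebra_simps)
  show "c = 1"
  proof (rule ccontr)
    assume "c \<noteq> 1"
    then consider "c < 1" | "c > 1" by linarith
    then show False
    proof cases
      case 1
      then have "c powr p \<le> c" using powr_mono'[of 1 p c] p c by simp
      then have "(c powr p - c) * wtail x \<le> 0" by (intro mult_nonpos_nonneg) auto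
      moreover have "\<beta> * (1 - c) > 0" using 1 \<beta> by simp
      ultimately show False using 2 by simp
    next
      case prems: 2
      then have "c powr p \<ge> c" using powr_mono[of 1 p c] p by simp
      then have "(c powr p - c) * wtail x \<ge> 0" by (intro mult_nonneg_nonneg) auto
      moreover have "\<beta> * (1 - c) < 0" using prems \<beta> by (simp add: mult_pos_neg)
      ultimately show False using 2 by simp
    qed
  qed
qed

text \<open>The absolute Jacobian of \<open>unscale\<close>: \<open>s\<close> for the first
  coordinate and \<open>s powr (1 / p)\<close> for each of the others.\<close>

definition slice_vol :: "real \<Rightarrow> real" where
  "slice_vol s = s powr ((real CARD('n) + p - 1) / p)"

lemma unscale_affine:
  "unscale \<sigma> s = (\<lambda>x. axis coord1 (\<sigma> * a coord1) + x) \<circ>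
     (\<lambda>x. \<chi> k. (if k = coord1 then - \<sigma> * s else s powr (1 / p)) * x $ k)"
  by (auto simp: fun_eq_iff unscale_def vec_eq_iff axis_def algebra_simps)

lemma measure_unscale:
  assumes "S \<in> lmeasurable" "\<sigma> \<in> {-1, 1}" "0 < s"
  shows "unscale \<sigma> s ` S \<in> lmeasurable" "measure lebesgue (unscale \<sigma> s ` S) = slice_vol s * measure lebesgue S"
proof -
  let ?m = "\<lambda>k :: 'n. if k = coord1 then - \<sigma> * s else s powr (1 / p)"
  have "prod ?m UNIV = ?m coord1 * prod ?m (- {coord1})"
    by (subst prod.remove[of _ coord1]) (auto simp: Compl_eq_Diff_UNIV)
  also have "prod ?m (- {coord1}) = (\<Prod>k\<in>- {coord1::'n}. s powr (1 / p))"
    by (intro prod.cong) auto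
  also have "\<dots> = s powr ((real CARD('n) - 1) / p)"
  proof -
    have "card (- {coord1 :: 'n}) = CARD('n) - 1" by (simp add: Compl_eq_Diff_UNIV card_Diff_singleton)
    then have "real (card (- {coord1 :: 'n})) = real CARD('n) - 1"
      by (simp add: of_nat_diff Suc_leI)
    then show ?thesis using assms(3) by (simp add: powr_powr flip: powr_realpow)
  qed
  finally have "\<bar>prod ?m UNIV\<bar> = s * s powr ((real CARD('n) - 1) / p)"
    using assms by (auto simp: abs_mult)
  also have "\<dots> = s powr (1 + (real CARD('n) - 1) / p)"
    using assms(3) by (simp add: powr_add)
  also have "\<dots> = slice_vol s"
    unfolding slice_vol_def using p by (intro arg_cong2[where f = "(powr)"]) (auto simp: field_simps)
  finally have prod: "\<bar>prod ?m UNIV\<bar> = slice_vol s" .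
  show "unscale \<sigma> s ` S \<in> lmeasurable"
    unfolding unscale_affine image_comp[symmetric]
    by (intro measurable_translation measurable_stretch assms)
  show "measure lebesgue (unscale \<sigma> s ` S) = slice_vol s * measure lebesgue S"
    unfolding unscale_affine image_comp[symmetric]
    by (simp only: measure_translation measure_stretch[OF assms(1)] prod)
qed

lemma continuous_unscale: "continuous_on S (unscale \<sigma> s)"
  unfolding unscale_affine comp_def
  by (intro continuous_intros)

lemma continuous_rescale:
  assumes "0 < s"
  shows "continuous_on S (rescale \<sigma> s)"
proof -
  have "continuous_on S (\<lambda>z. if k = coord1 then (a coord1 - \<sigma> * z $ coord1) / s else z $ k / s powr (1 / p))"
    for k
    using assms by (cases "k = coord1") (auto intro!: continuous_intros)
  then show ?thesis unfolding rescale_def by (intro continuous_on_vec_lambda)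
qed

end

section \<open>Mass near a pole\<close>

context elliptic_ball
begin

lemma slice_limit:
  assumes s: "s \<longlonglongrightarrow> 0" "\<And>k::nat. 0 < s k"
  shows "(\<lambda>k. (1 - \<bar>1 - s k * u\<bar> powr p) / s k) \<longlonglongrightarrow> p * u"
proof -
  have "((\<lambda>v. \<bar>1 - v * u\<bar> powr p) has_real_derivative (- p * u)) (at 0)"
  proof (rule has_field_derivative_transform_within)
    show "((\<lambda>v. (1 - v * u) powr p) has_real_derivative (- p * u)) (at 0)"
      by (auto intro!: derivative_eq_intros)
    show "0 < 1 / (1 + \<bar>u\<bar>)" "0 \<in> UNIV" by simp_all
    show "(1 - v * u) powr p = \<bar>1 - v * u\<bar> powr p" if "v \<in> UNIV" "dist v 0 < 1 / (1 + \<bar>u\<bar>)" for v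
    proof -
      have "\<bar>v\<bar> * (1 + \<bar>u\<bar>) < 1" using that(2) by (simp add: field_simps)
      then have "\<bar>v * u\<bar> < 1" by (simp add: abs_mult algebra_simps)
      then show ?thesis by simp
    qed
  qed
  then obtain g where g: "\<And>v. \<bar>1 - v * u\<bar> powr p - \<bar>1 - 0 * u\<bar> powr p = g v * (v - 0)"
    and "isCont g 0" and g0: "g 0 = - p * u"
    unfolding CARAT_DERIV by blast
  have "(\<lambda>k. - g (s k)) \<longlonglongrightarrow> - g 0"
    by (intro tendsto_minus isCont_tendsto_compose[OF \<open>isCont g 0\<close>] s)
  moreover have "- g (s k) = (1 - \<bar>1 - s k * u\<bar> powr p) / s k" for k
    using g[of "s k"] s(2)[of k] by (simp add: field_simps)
  ultimately show ?thesis by (simp add: g0)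
qed

lemma rescale_vimage:
  assumes "\<sigma> \<in> {-1, 1}" "0 < s"
  shows "{z \<in> ellipsoid p a. rescale \<sigma> s z \<in> C} = unscale \<sigma> s ` {x \<in> C. unscale \<sigma> s x \<in> ellipsoid p a}"
proof (intro equalityI subsetI)
  fix z assume z: "z \<in> {z \<in> ellipsoid p a. rescale \<sigma> s z \<in> C}"
  then have "z = unscale \<sigma> s (rescale \<sigma> s z)" using unscale_rescale[OF assms] by simp
  with z show "z \<in> unscale \<sigma> s ` {x \<in> C. unscale \<sigma> s x \<in> ellipsoid p a}" by auto
next
  fix z assume "z \<in> unscale \<sigma> s ` {x \<in> C. unscale \<sigma> s x \<in> ellipsoid p a}"
  then show "z \<in> {z \<in> ellipsoid p a. rescale \<sigma> s z \<in> C}"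
    using rescale_unscale[OF assms] by auto
qed

lemma sets_unscale_vimage:
  assumes "C \<in> sets borel"
  shows "{x \<in> C. unscale \<sigma> s x \<in> ellipsoid p a} \<in> sets borel"
proof -
  have "closed {x. unscale \<sigma> s x \<in> ellipsoid p a}"
    using continuous_closed_vimage[OF closed_ellipsoid, of "unscale \<sigma> s"] continuous_unscale[of UNIV \<sigma> s]
    by (auto simp: vimage_def continuous_on_eq_continuous_at)
  then have "C \<inter> {x. unscale \<sigma> s x \<in> ellipsoid p a} \<in> sets borel"
    using assms by (intro sets.Int) auto
  then show ?thesis by (simp add: Int_def)
qed

lemma sets_rescale_vimage:
  assumes "C \<in> sets borel" "0 < s"
  shows "{z. rescale \<sigma> s z \<in> C} \<in> sets borel"
  using measurable_sets[OF borel_measurable_continuous_onI[OF continuous_rescale[OF assms(2), of UNIV \<sigma>]] assms(1)]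
  by (simp add: vimage_def)

lemma bounded_borel_lmeasurable:
  fixes C :: "(real ^ 'n::{finite,linorder}) set"
  assumes "bounded C" "C \<in> sets borel"
  shows "C \<in> lmeasurable"
  using assms by (intro bounded_set_imp_lmeasurable) auto

text \<open>Dominated convergence inside \<open>C\<close>: for a point off the boundary of the
  paraboloid, \<open>slice_limit\<close> decides membership in the rescaled ellipsoid for all large
  \<open>k\<close>, and the boundary is a null set.\<close>

lemma measure_slices:
  assumes C: "bounded C" "C \<in> sets borel" and \<sigma>: "\<sigma> \<in> {-1, 1}"
    and s: "s \<longlonglongrightarrow> 0" "\<And>k::nat. 0 < s k"
  shows "(\<lambda>k. measure lebesgue {x \<in> C. unscale \<sigma> (s k) x \<in> ellipsoid p a}) \<longlonglongrightarrow> measure lebesgue (C \<inter> paraboloid p a)"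
proof -
  let ?S = "\<lambda>k. {x \<in> C. unscale \<sigma> (s k) x \<in> ellipsoid p a}"
  have C': "C \<in> lmeasurable" by (rule bounded_borel_lmeasurable[OF C])
  have P: "paraboloid p a \<in> sets borel" using closed_paraboloid by auto
  have "(\<lambda>k. integral\<^sup>L lebesgue (indicator (?S k) :: _ \<Rightarrow> real)) \<longlonglongrightarrow> integral\<^sup>L lebesgue (indicator (C \<inter> paraboloid p a) :: _ \<Rightarrow> real)"
  proof (rule integral_dominated_convergence[where w = "indicator C"])
    show "integrable lebesgue (indicator C :: _ \<Rightarrow> real)"
      using C' by (simp add: lmeasurable_iff_integrable)
    show "(indicator (?S k) :: _ \<Rightarrow> real) \<in> borel_measurable lebesgue" for k
      using sets_unscale_vimage[OF C(2)] by (intro borel_measurable_indicator) auto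
    show "(indicator (C \<inter> paraboloid p a) :: _ \<Rightarrow> real) \<in> borel_measurable lebesgue"
      using C P by (intro borel_measurable_indicator) auto
    show "AE x in lebesgue. norm (indicator (?S k) x :: real) \<le> indicator C x" for k
      by (auto simp: indicator_def)
    have "AE x in lebesgue. x \<notin> {x. wtail x = p * x $ coord1 / a coord1}"
      using negligible_paraboloid_boundary by (intro AE_not_in) (simp add: negligible_iff_null_sets)
    then show "AE x in lebesgue. (\<lambda>k. indicator (?S k) x :: real) \<longlonglongrightarrow> indicator (C \<inter> paraboloid p a) x"
    proof eventually_elim
      case (elim x)
      have lim: "(\<lambda>k. (1 - \<bar>1 - s k * (x $ coord1 / a coord1)\<bar> powr p) / s k) \<longlonglongrightarrow> p * (x $ coord1 / a coord1)"
        by (rule slice_limit[OF s])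
      have "\<forall>\<^sub>F k in sequentially. (unscale \<sigma> (s k) x \<in> ellipsoid p a) = (x \<in> paraboloid p a)"
      proof (cases "wtail x < p * x $ coord1 / a coord1")
        case True
        then show ?thesis
          using order_tendstoD(1)[OF lim, of "wtail x"]
          by (auto simp: unscale_mem_ellipsoid[OF \<sigma> s(2)] mem_paraboloid elim!: eventually_mono)
      next
        case False
        then have "wtail x > p * x $ coord1 / a coord1" using elim by auto
        then show ?thesis
          using order_tendstoD(2)[OF lim, of "wtail x"]
          by (auto simp: unscale_mem_ellipsoid[OF \<sigma> s(2)] mem_paraboloid elim!: eventually_mono)
      qed
      then have "\<forall>\<^sub>F k in sequentially. (indicator (?S k) x :: real) = indicator (C \<inter> paraboloid p a) x"
        by eventually_elim (auto simp: indicator_def)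
      then show ?case by (rule tendsto_eventually)
    qed
  qed
  then show ?thesis by simp
qed

lemma measure_rescale_vimage:
  assumes C: "bounded C" "C \<in> sets borel" and \<sigma>: "\<sigma> \<in> {-1, 1}" and s: "0 < s"
  shows "{z \<in> ellipsoid p a. rescale \<sigma> s z \<in> C} \<in> lmeasurable"
    "measure lebesgue {z \<in> ellipsoid p a. rescale \<sigma> s z \<in> C}
      = slice_vol s * measure lebesgue {x \<in> C. unscale \<sigma> s x \<in> ellipsoid p a}"
proof -
  have "{x \<in> C. unscale \<sigma> s x \<in> ellipsoid p a} \<in> lmeasurable"
    using C by (intro bounded_borel_lmeasurable sets_unscale_vimage) (auto intro: bounded_subset)
  from measure_unscale[OF this \<sigma> s]
  show "{z \<in> ellipsoid p a. rescale \<sigma> s z \<in> C} \<in> lmeasurable"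
    "measure lebesgue {z \<in> ellipsoid p a. rescale \<sigma> s z \<in> C}
      = slice_vol s * measure lebesgue {x \<in> C. unscale \<sigma> s x \<in> ellipsoid p a}"
    by (simp_all add: rescale_vimage[OF \<sigma> s])
qed

lemma unscale_near_pole:
  assumes s: "s \<longlonglongrightarrow> 0" "\<And>k::nat. 0 < s k" and \<sigma>: "\<sigma> \<in> {-1, 1}" and \<delta>: "0 < \<delta>"
  shows "\<forall>\<^sub>F k in sequentially. \<forall>x. norm x \<le> L \<longrightarrow> dist (unscale \<sigma> (s k) x) (axis coord1 (\<sigma> * a coord1)) < \<delta>"
proof -
  \<comment> \<open>A bound for the displacement in the sum norm: adding both scales covers every
    coordinate, and summation contributes the dimension.\<close>
  define c where "c k = (s k + s k powr (1 / p)) * (real CARD('n) * \<bar>L\<bar>)" for k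
  have "dist (unscale \<sigma> (s k) x) (axis coord1 (\<sigma> * a coord1)) \<le> c k" if x: "norm x \<le> L" for k x
  proof -
    let ?d = "unscale \<sigma> (s k) x - axis coord1 (\<sigma> * a coord1)"
    have "\<bar>?d $ i\<bar> \<le> (s k + s k powr (1 / p)) * \<bar>L\<bar>" for i
    proof -
      have "\<bar>?d $ i\<bar> = (if i = coord1 then s k else s k powr (1 / p)) * \<bar>x $ i\<bar>"
        using \<sigma> s(2)[of k] by (auto simp: unscale_def axis_def abs_mult algebra_simps)
      also have "\<dots> \<le> (s k + s k powr (1 / p)) * \<bar>L\<bar>"
        using s(2)[of k] component_le_norm_cart[of x i] x by (intro mult_mono) (auto simp: less_imp_le)
      finally show ?thesis .
    qed
    then have "(\<Sum>i\<in>UNIV. \<bar>?d $ i\<bar>) \<le> (\<Sum>i\<in>(UNIV::'n set). (s k + s k powr (1 / p)) * \<bar>L\<bar>)"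
      by (intro sum_mono)
    then show ?thesis
      using norm_le_l1_cart[of ?d] by (simp add: dist_norm c_def algebra_simps)
  qed
  moreover have "c \<longlonglongrightarrow> (0 + 0 powr (1 / p)) * (real CARD('n) * \<bar>L\<bar>)"
    unfolding c_def using p s(2)
    by (intro tendsto_mult tendsto_add s tendsto_powr' tendsto_const)
       (auto simp: less_imp_le intro!: always_eventually)
  then have "c \<longlonglongrightarrow> 0" by simp
  ultimately show ?thesis
    using order_tendstoD(2)[OF \<open>c \<longlonglongrightarrow> 0\<close> \<delta>]
    by (auto elim!: eventually_mono intro: le_less_trans)
qed

text \<open>The preimage of \<open>C\<close> shrinks to the pole, so continuity there replaces the
  density by its value at the pole; what remains is the volume from
  \<open>measure_slices\<close>.\<close>

lemma integral_near_pole: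
  assumes C: "bounded C" "C \<in> sets borel" and \<sigma>: "\<sigma> \<in> {-1, 1}"
    and s: "s \<longlonglongrightarrow> 0" "\<And>k::nat. 0 < s k"
    and f: "set_integrable lebesgue (ellipsoid p a) f"
    and cont: "continuous (at (axis coord1 (\<sigma> * a coord1)) within ellipsoid p a) f"
  shows "(\<lambda>k. (LINT z:{z \<in> ellipsoid p a. rescale \<sigma> (s k) z \<in> C}|lebesgue. f z) / slice_vol (s k))
    \<longlonglongrightarrow> f (axis coord1 (\<sigma> * a coord1)) * measure lebesgue (C \<inter> paraboloid p a)"
proof -
  let ?D = "\<lambda>k. {z \<in> ellipsoid p a. rescale \<sigma> (s k) z \<in> C}"
  let ?S = "\<lambda>k. {x \<in> C. unscale \<sigma> (s k) x \<in> ellipsoid p a}"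
  define f0 where "f0 = f (axis coord1 (\<sigma> * a coord1))"
  define I where "I k = (LINT z:?D k|lebesgue. f z) / slice_vol (s k)" for k
  obtain L where L: "\<And>x. x \<in> C \<Longrightarrow> norm x \<le> L" using C(1) by (auto simp: bounded_iff)
  have "(\<lambda>k. I k - f0 * measure lebesgue (?S k)) \<longlonglongrightarrow> 0"
  proof (rule tendstoI)
    fix \<epsilon> :: real assume "0 < \<epsilon>"
    \<comment> \<open>The summand \<open>1\<close> allows \<open>C\<close> to have measure
      \<open>0\<close>.\<close>
    define \<eta> where "\<eta> = \<epsilon> / (measure lebesgue C + 1)"
    have mC: "measure lebesgue C + 1 > 0" using measure_nonneg[of lebesgue C] by linarith
    have "0 < \<eta>" using \<open>0 < \<epsilon>\<close> mC by (simp add: \<eta>_def)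
    then obtain \<delta> where \<delta>: "0 < \<delta>"
      "\<And>z. z \<in> ellipsoid p a \<Longrightarrow> dist z (axis coord1 (\<sigma> * a coord1)) < \<delta> \<Longrightarrow> dist (f z) f0 < \<eta>"
      using cont unfolding continuous_within_eps_delta f0_def by metis
    show "\<forall>\<^sub>F k in sequentially. dist (I k - f0 * measure lebesgue (?S k)) 0 < \<epsilon>"
      using unscale_near_pole[OF s \<sigma> \<delta>(1), of L]
    proof eventually_elim
      case (elim k)
      have D: "?D k \<in> lmeasurable" and mD: "measure lebesgue (?D k) = slice_vol (s k) * measure lebesgue (?S k)"
        using measure_rescale_vimage[OF C \<sigma> s(2)] by auto
      have pos: "slice_vol (s k) > 0" using s(2)[of k] by (simp add: slice_vol_def)
      have near: "\<bar>f z - f0\<bar> \<le> \<eta>" if "z \<in> ?D k" for z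
      proof -
        have "rescale \<sigma> (s k) z \<in> C" "z \<in> ellipsoid p a" using that by auto
        then have "dist (unscale \<sigma> (s k) (rescale \<sigma> (s k) z)) (axis coord1 (\<sigma> * a coord1)) < \<delta>"
          using elim L by blast
        then show ?thesis
          using \<delta>(2) \<open>z \<in> ellipsoid p a\<close> unscale_rescale[OF \<sigma> s(2)] by (auto simp: dist_real_def less_imp_le)
      qed
      have fD: "set_integrable lebesgue (?D k) f"
        by (rule set_integrable_subset[OF f]) (use D in auto)
      have cD: "set_integrable lebesgue (?D k) (\<lambda>z. c)" for c :: real
        using D by (simp add: set_integrable_def lmeasurable_iff_integrable)
      have "(LINT z:?D k|lebesgue. f z) - f0 * measure lebesgue (?D k) = (LINT z:?D k|lebesgue. f z - f0)"
        using fD cD[of f0] D by (subst set_integral_diff) (auto simp: set_lebesgue_integral_def)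
      also have "\<bar>\<dots>\<bar> \<le> (LINT z:?D k|lebesgue. \<bar>f z - f0\<bar>)"
        using set_integral_norm_bound[of lebesgue "?D k" "\<lambda>z. f z - f0"] set_integral_diff(1)[OF fD cD[of f0]] by simp
      also have "\<dots> \<le> (LINT z:?D k|lebesgue. \<eta>)"
        by (rule set_integral_mono[OF set_integrable_abs[OF set_integral_diff(1)[OF fD cD]] cD near]) 
      also have "\<dots> = \<eta> * measure lebesgue (?D k)"
        using D by (simp add: set_lebesgue_integral_def)
      finally have "\<bar>(LINT z:?D k|lebesgue. f z) - f0 * measure lebesgue (?D k)\<bar> \<le> \<eta> * measure lebesgue (?D k)" .
      then have "\<bar>((LINT z:?D k|lebesgue. f z) - f0 * measure lebesgue (?D k)) / slice_vol (s k)\<bar>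
         \<le> \<eta> * measure lebesgue (?D k) / slice_vol (s k)"
        using pos by (simp add: abs_div divide_right_mono)
      then have "\<bar>I k - f0 * measure lebesgue (?S k)\<bar> \<le> \<eta> * measure lebesgue (?S k)"
        using pos by (simp add: I_def mD diff_divide_distrib)
      also have "\<dots> \<le> \<eta> * measure lebesgue C"
        using \<open>0 < \<eta>\<close> C sets_unscale_vimage[OF C(2)]
        by (intro mult_left_mono measure_mono_fmeasurable bounded_borel_lmeasurable) auto
      also have "\<dots> < \<eta> * (measure lebesgue C + 1)" using \<open>0 < \<eta>\<close> by simp
      also have "\<dots> = \<epsilon>" using mC by (simp add: \<eta>_def)
      finally show ?case by simp
    qed
  qed
  moreover have "(\<lambda>k. f0 * measure lebesgue (?S k)) \<longlonglongrightarrow> f0 * measure lebesgue (C \<inter> paraboloid p a)"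
    by (intro tendsto_mult_left measure_slices C \<sigma> s)
  ultimately have "(\<lambda>k. (I k - f0 * measure lebesgue (?S k)) + f0 * measure lebesgue (?S k))
      \<longlonglongrightarrow> 0 + f0 * measure lebesgue (C \<inter> paraboloid p a)"
    by (rule tendsto_add)
  then show ?thesis by (simp add: I_def f0_def)
qed

end

section \<open>Discretisation\<close>

context elliptic_ball
begin

lemma pnorm_minus_commute: "pnorm_on I p (z - w) = pnorm_on I p (w - z)"
  by (simp add: pnorm_on_def abs_minus_commute)

text \<open>Nearly diametral pairs lie on opposite sides, by \<open>pnorm_diff_same_side\<close>,
  and at bounded rescaled depth, by \<open>pnorm_diff_le\<close>. Which of the two points is near
  the left pole is unknown, hence the disjunction.\<close>

lemma close_to_diameter:
  shows "\<exists>s0>0. \<forall>s z w. 0 < s \<longrightarrow> s < s0 \<longrightarrow> z \<in> ellipsoid p a \<longrightarrow> w \<in> ellipsoid p a \<longrightarrow>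
     2 * a coord1 - pnorm_on UNIV p (z - w) \<le> s * t \<longrightarrow>
     (\<exists>x y. (x = rescale (-1) s z \<and> y = rescale 1 s w \<or> x = rescale (-1) s w \<and> y = rescale 1 s z) \<and>
       x \<in> paraboloid p a \<and> y \<in> paraboloid p a \<and> x $ coord1 \<le> t / gap \<and> y $ coord1 \<le> t / gap \<and>
       pre_value s x y \<le> t)"
proof -
  let ?A = "a coord1"
  \<comment> \<open>A positive lower bound for the defect of a pair on one side.\<close>
  define \<theta> where "\<theta> = 2 * ?A * (1 - ((1 + \<kappa>) / 2) powr (1 / p))"
  have "((1 + \<kappa>) / 2) powr (1 / p) < 1 powr (1 / p)"
    using p \<kappa>_less_1 \<kappa>_nonneg by (intro powr_less_mono2) auto
  then have \<theta>: "\<theta> > 0" using a_pos[of coord1] by (simp add: \<theta>_def)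
  have ordered: "rescale (-1) s z \<in> paraboloid p a \<and> rescale 1 s w \<in> paraboloid p a \<and>
      rescale (-1) s z $ coord1 \<le> t / gap \<and> rescale 1 s w $ coord1 \<le> t / gap \<and>
      pre_value s (rescale (-1) s z) (rescale 1 s w) \<le> t"
    if s: "0 < s" and zw: "z \<in> ellipsoid p a" "w \<in> ellipsoid p a" "z $ coord1 < 0" "0 < w $ coord1"
      and le: "2 * ?A - pnorm_on UNIV p (z - w) \<le> s * t" for s z w
  proof -
    let ?x = "rescale (-1) s z" and ?y = "rescale 1 s w"
    have P: "?x \<in> paraboloid p a" "?y \<in> paraboloid p a"
      using zw s by (auto intro!: rescale_mem_paraboloid)
    have "?x $ coord1 = (?A - \<bar>z $ coord1\<bar>) / s" "?y $ coord1 = (?A - \<bar>w $ coord1\<bar>) / s"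
      using zw by (auto simp: rescale_def)
    then have "s * ?x $ coord1 = ?A - \<bar>z $ coord1\<bar>" "s * ?y $ coord1 = ?A - \<bar>w $ coord1\<bar>"
      using s by auto
    moreover have "s * (gap * (?x $ coord1 + ?y $ coord1)) = gap * (s * ?x $ coord1 + s * ?y $ coord1)"
      by (simp add: algebra_simps)
    ultimately have "s * (gap * (?x $ coord1 + ?y $ coord1)) = gap * ((?A - \<bar>z $ coord1\<bar>) + (?A - \<bar>w $ coord1\<bar>))"
      by simp
    also have "\<dots> \<le> s * t" using pnorm_diff_le[OF zw(1,2)] le by linarith
    finally have "gap * (?x $ coord1 + ?y $ coord1) \<le> t" using s by simp
    then have "?x $ coord1 + ?y $ coord1 \<le> t / gap" using gap_pos by (simp add: field_simps)
    moreover have "0 \<le> ?x $ coord1" "0 \<le> ?y $ coord1" using P by (auto intro: paraboloid_coord1_nonneg)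
    moreover have "pre_value s ?x ?y \<le> t"
      unfolding pre_value_def using le s by (simp add: unscale_rescale divide_le_eq mult.commute)
    ultimately show ?thesis using P by auto
  qed
  have "\<exists>x y. (x = rescale (-1) s z \<and> y = rescale 1 s w \<or> x = rescale (-1) s w \<and> y = rescale 1 s z) \<and>
       x \<in> paraboloid p a \<and> y \<in> paraboloid p a \<and> x $ coord1 \<le> t / gap \<and> y $ coord1 \<le> t / gap \<and>
       pre_value s x y \<le> t"
    if s: "0 < s" "s < \<theta> / (\<bar>t\<bar> + 1)" and zw: "z \<in> ellipsoid p a" "w \<in> ellipsoid p a"
      and le: "2 * ?A - pnorm_on UNIV p (z - w) \<le> s * t" for s z w
  proof -
    \<comment> \<open>Since \<open>t\<close> may be negative or \<open>0\<close>, the threshold on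
      \<open>s\<close> was divided by \<open>\<bar>t\<bar> + 1\<close> instead of
      \<open>t\<close>.\<close>
    have "s * t \<le> s * (\<bar>t\<bar> + 1)" using s by (intro mult_left_mono) auto
    also have "\<dots> < \<theta>" using s by (simp add: less_divide_eq)
    finally have "\<not> 0 \<le> z $ coord1 * w $ coord1"
      using pnorm_diff_same_side[OF zw] le by (auto simp: \<theta>_def algebra_simps)
    then have "z $ coord1 < 0 \<and> 0 < w $ coord1 \<or> w $ coord1 < 0 \<and> 0 < z $ coord1"
      by (auto simp: zero_le_mult_iff not_le)
    then show ?thesis
      using ordered[OF s(1) zw _ _ le] ordered[OF s(1) zw(2,1)] le pnorm_minus_commute[of UNIV z w] by metis
  qed
  moreover have "0 < \<theta> / (\<bar>t\<bar> + 1)" using \<theta> by simp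
  ultimately show ?thesis by blast
qed

lemma bounded_paraboloid_cap: "bounded {x \<in> paraboloid p a. x $ coord1 \<le> R}"
proof -
  \<comment> \<open>At least \<open>1\<close>, because the step from a p-th power back to its base
    uses \<open>v \<le> max 1 (v powr p)\<close>.\<close>
  define c where "c = max 1 (p * R / a coord1)"
  have "\<bar>x $ k\<bar> \<le> a coord1 * c + \<bar>R\<bar>" if x: "x \<in> paraboloid p a" "x $ coord1 \<le> R" for x k
  proof (cases "k = coord1")
    case True
    then show ?thesis
      using x paraboloid_coord1_nonneg[OF x(1)] a_pos[of coord1] by (auto simp: c_def intro!: add_increasing)
  next
    case False
    have "(\<bar>x $ k\<bar> / a k) powr p \<le> wtail x"
      unfolding wtail_def using False by (intro member_le_sum) auto
    also have "\<dots> \<le> p * x $ coord1 / a coord1" using x by (simp add: mem_paraboloid)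
    also have "\<dots> \<le> p * R / a coord1"
      using x p a_pos[of coord1] by (intro divide_right_mono mult_left_mono) auto
    finally have "(\<bar>x $ k\<bar> / a k) powr p \<le> c" by (simp add: c_def)
    moreover have "v \<le> max 1 (v powr p)" if "0 \<le> v" for v :: real
      using powr_mono[of 1 p v] p that by (cases "v \<le> 1") auto
    ultimately have "\<bar>x $ k\<bar> / a k \<le> c"
      using a_pos[of k] by (smt (verit) c_def divide_nonneg_pos max.bounded_iff)
    then have "\<bar>x $ k\<bar> \<le> a k * c" using a_pos[of k] by (simp add: divide_le_eq mult.commute)
    also have "\<dots> \<le> a coord1 * c" using a_first[OF False] by (intro mult_right_mono) (auto simp: c_def)
    finally show ?thesis by linarith
  qed
  then have "(\<Sum>k\<in>UNIV. \<bar>x $ k\<bar>) \<le> (\<Sum>k\<in>(UNIV::'n set). a coord1 * c + \<bar>R\<bar>)"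
    if "x \<in> paraboloid p a" "x $ coord1 \<le> R" for x
    using that by (intro sum_mono)
  then show ?thesis
    unfolding bounded_iff using norm_le_l1_cart order_trans by blast
qed

lemma compact_paraboloid_cap: "compact {x \<in> paraboloid p a. x $ coord1 \<le> R}"
proof -
  have "closed (paraboloid p a \<inter> {x. x $ coord1 \<le> R})"
    by (intro closed_Int closed_paraboloid closed_Collect_le continuous_intros)
  then show ?thesis
    using bounded_paraboloid_cap by (simp add: compact_eq_bounded_closed Int_def)
qed

lemma continuous_tail: "continuous_on S tail"
  unfolding tail_def using p
  by (intro continuous_on_sum continuous_on_powr' continuous_intros) auto

lemma continuous_limit_value: "continuous_on S (\<lambda>(x, y). limit_value p a x y)"
  unfolding limit_value_eq case_prod_unfold
  by (intro continuous_intros continuous_on_compose2[OF continuous_tail[of UNIV]]) auto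

lemma limit_value_uniform:
  assumes "0 < \<epsilon>"
  shows "\<exists>\<delta>>0. \<delta> \<le> 1 \<and> (\<forall>x y c c'. norm c \<le> L \<longrightarrow> norm c' \<le> L \<longrightarrow> dist c x < \<delta> \<longrightarrow> dist c' y < \<delta> \<longrightarrow>
     \<bar>limit_value p a x y - limit_value p a c c'\<bar> < \<epsilon>)"
proof -
  let ?B = "cball (0 :: real ^ 'n::{finite,linorder}) (L + 1)"
  have "uniformly_continuous_on (?B \<times> ?B) (\<lambda>(x, y). limit_value p a x y)"
    by (intro compact_uniformly_continuous continuous_limit_value compact_Times compact_cball)
  then obtain d where d: "0 < d" "\<And>u v. u \<in> ?B \<times> ?B \<Longrightarrow> v \<in> ?B \<times> ?B \<Longrightarrow> dist v u < d \<Longrightarrow>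
      dist (case v of (x, y) \<Rightarrow> limit_value p a x y) (case u of (x, y) \<Rightarrow> limit_value p a x y) < \<epsilon>"
    using assms unfolding uniformly_continuous_on_def by metis
  show ?thesis
  \<comment> \<open>The bound \<open>1\<close> keeps \<open>x\<close> and \<open>y\<close> in the
    ball of radius \<open>L + 1\<close>; the half of \<open>d\<close> is due to the distance of two
    pairs being at most the sum of the distances of their components.\<close>
  proof (intro exI[of _ "min 1 (d / 2)"] conjI allI impI)
    fix x y c c' :: "real ^ 'n::{finite,linorder}"
    assume *: "norm c \<le> L" "norm c' \<le> L" "dist c x < min 1 (d / 2)" "dist c' y < min 1 (d / 2)"
    have "norm x \<le> L + 1" "norm y \<le> L + 1"
      using * norm_triangle_ineq2[of x c] norm_triangle_ineq2[of y c'] by (auto simp: dist_norm norm_minus_commute)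
    moreover have "dist (x, y) (c, c') < d"
      using * dist_Pair_Pair[of x y c c'] sqrt_sum_squares_le_sum[of "dist x c" "dist y c'"]
      by (auto simp: dist_commute)
    ultimately show "\<bar>limit_value p a x y - limit_value p a c c'\<bar> < \<epsilon>"
      using d(2)[of "(c, c')" "(x, y)"] * by (auto simp: dist_real_def)
  qed (use d in auto)
qed

text \<open>One finite family of ball pairs serves the samples and the limit alike. The converse
  bounds hold for arbitrary points of the balls, since occupancy is all that the events
  record.\<close>

lemma discretisation:
  assumes "0 < \<epsilon>"
  obtains W :: "((real ^ 'n::{finite,linorder}) \<times> (real ^ 'n::{finite,linorder})) set" and \<delta> s0 :: real
  where "finite W" "0 < \<delta>" "0 < s0"
    "\<And>s z w. 0 < s \<Longrightarrow> s < s0 \<Longrightarrow> z \<in> ellipsoid p a \<Longrightarrow> w \<in> ellipsoid p a \<Longrightarrow>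
      2 * a coord1 - pnorm_on UNIV p (z - w) \<le> s * t \<Longrightarrow>
      \<exists>(c, c')\<in>W. rescale (-1) s z \<in> ball c \<delta> \<and> rescale 1 s w \<in> ball c' \<delta> \<or>
                 rescale (-1) s w \<in> ball c \<delta> \<and> rescale 1 s z \<in> ball c' \<delta>"
    "\<And>s z w c c'. 0 < s \<Longrightarrow> s < s0 \<Longrightarrow> (c, c') \<in> W \<Longrightarrow> rescale (-1) s z \<in> ball c \<delta> \<Longrightarrow>
      rescale 1 s w \<in> ball c' \<delta> \<Longrightarrow> 2 * a coord1 - pnorm_on UNIV p (z - w) \<le> s * (t + \<epsilon>)"
    "\<And>x y. x \<in> paraboloid p a \<Longrightarrow> y \<in> paraboloid p a \<Longrightarrow> limit_value p a x y \<le> t \<Longrightarrow>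
      \<exists>(c, c')\<in>W. x \<in> ball c \<delta> \<and> y \<in> ball c' \<delta>"
    "\<And>x y c c'. (c, c') \<in> W \<Longrightarrow> x \<in> ball c \<delta> \<Longrightarrow> y \<in> ball c' \<delta> \<Longrightarrow> limit_value p a x y \<le> t + \<epsilon>"
proof -
  define K where "K = {x \<in> paraboloid p a. x $ coord1 \<le> t / gap}"
  have "compact K" unfolding K_def by (rule compact_paraboloid_cap)
  then obtain L where L: "\<And>x. x \<in> K \<Longrightarrow> norm x \<le> L"
    using compact_imp_bounded bounded_iff by metis
  have e4: "0 < \<epsilon> / 4" using assms by simp
  obtain \<delta> where \<delta>: "0 < \<delta>" "\<delta> \<le> 1" "\<And>x y c c'. norm c \<le> L \<Longrightarrow> norm c' \<le> L \<Longrightarrow> dist c x < \<delta> \<Longrightarrow>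
      dist c' y < \<delta> \<Longrightarrow> \<bar>limit_value p a x y - limit_value p a c c'\<bar> < \<epsilon> / 4"
    using limit_value_uniform[OF e4, of L] by metis
  obtain s1 where s1: "0 < s1" "\<And>s x y. 0 < s \<Longrightarrow> s < s1 \<Longrightarrow> norm x \<le> L + 1 \<Longrightarrow> norm y \<le> L + 1 \<Longrightarrow>
      \<bar>pre_value s x y - limit_value p a x y\<bar> < \<epsilon> / 4"
    using pre_value_uniform[OF e4, of "L + 1"] by metis
  obtain s2 where s2: "0 < s2" "\<And>s z w. 0 < s \<Longrightarrow> s < s2 \<Longrightarrow> z \<in> ellipsoid p a \<Longrightarrow> w \<in> ellipsoid p a \<Longrightarrow>
     2 * a coord1 - pnorm_on UNIV p (z - w) \<le> s * t \<Longrightarrow>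
     \<exists>x y. (x = rescale (-1) s z \<and> y = rescale 1 s w \<or> x = rescale (-1) s w \<and> y = rescale 1 s z) \<and>
       x \<in> paraboloid p a \<and> y \<in> paraboloid p a \<and> x $ coord1 \<le> t / gap \<and> y $ coord1 \<le> t / gap \<and>
       pre_value s x y \<le> t"
    using close_to_diameter[of t] by metis
  obtain F where F: "finite F" "F \<subseteq> K" "K \<subseteq> (\<Union>c\<in>F. ball c \<delta>)"
    using compactE_image[OF \<open>compact K\<close>, of K "\<lambda>c. ball c \<delta>"] \<delta>(1)
    by (metis (no_types, lifting) UN_I centre_in_ball open_ball subsetI)
  \<comment> \<open>The margin \<open>\<epsilon>\<close> is spent in quarters. Passing from
    \<open>pre_value\<close> to \<open>limit_value\<close> and from a pair to the centres costs two,
    which is the threshold here; the way back from the centres costs the other two.\<close>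
  define W where "W = {(c, c') \<in> F \<times> F. limit_value p a c c' \<le> t + \<epsilon> / 2}"
  have W_norm: "norm c \<le> L" "norm c' \<le> L" "limit_value p a c c' \<le> t + \<epsilon> / 2" if "(c, c') \<in> W" for c c'
    using that F(2) L by (auto simp: W_def)
  have cover: "\<exists>(c, c')\<in>W. x \<in> ball c \<delta> \<and> y \<in> ball c' \<delta>"
    if near: "x \<in> K" "y \<in> K" "limit_value p a x y \<le> t + \<epsilon> / 4" for x y
  proof -
    obtain c c' where c: "c \<in> F" "x \<in> ball c \<delta>" "c' \<in> F" "y \<in> ball c' \<delta>" using F(3) near by blast
    then have "\<bar>limit_value p a x y - limit_value p a c c'\<bar> < \<epsilon> / 4"
      using F(2) L by (intro \<delta>(3)) auto
    then have "limit_value p a c c' \<le> t + \<epsilon> / 2" using near(3) by linarith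
    then have "(c, c') \<in> W" using c by (auto simp: W_def)
    then show ?thesis using c by auto
  qed
  have norm_ball: "norm x \<le> L + 1" if "x \<in> ball c \<delta>" "norm c \<le> L" for x c :: "real ^ 'n::{finite,linorder}"
    using that \<delta>(2) norm_triangle_ineq2[of x c] by (auto simp: dist_norm norm_minus_commute)
  show ?thesis
  proof (rule that[of W \<delta> "min s1 s2"])
    show "finite W" using F(1) by (auto simp: W_def intro: finite_subset[of _ "F \<times> F"])
    show "0 < \<delta>" "0 < min s1 s2" using \<delta> s1 s2 by auto
  next
    fix s z w
    assume *: "0 < s" "s < min s1 s2" "z \<in> ellipsoid p a" "w \<in> ellipsoid p a"
      "2 * a coord1 - pnorm_on UNIV p (z - w) \<le> s * t"
    then obtain x y where xy: "x = rescale (-1) s z \<and> y = rescale 1 s w \<or> x = rescale (-1) s w \<and> y = rescale 1 s z"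
       and K: "x \<in> K" "y \<in> K" and le: "pre_value s x y \<le> t"
      using s2(2)[of s z w] by (auto simp: K_def)
    have "\<bar>pre_value s x y - limit_value p a x y\<bar> < \<epsilon> / 4"
      using L[OF K(1)] L[OF K(2)] * by (intro s1(2)) auto
    then have "limit_value p a x y \<le> t + \<epsilon> / 4" using le by linarith
    from cover[OF K this] xy show
      "\<exists>(c, c')\<in>W. rescale (-1) s z \<in> ball c \<delta> \<and> rescale 1 s w \<in> ball c' \<delta> \<or>
                 rescale (-1) s w \<in> ball c \<delta> \<and> rescale 1 s z \<in> ball c' \<delta>"
      by blast
  next
    fix s z w c c'
    assume *: "0 < s" "s < min s1 s2" "(c, c') \<in> W" "rescale (-1) s z \<in> ball c \<delta>" "rescale 1 s w \<in> ball c' \<delta>"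
    let ?x = "rescale (-1) s z" and ?y = "rescale 1 s w"
    have "\<bar>limit_value p a ?x ?y - limit_value p a c c'\<bar> < \<epsilon> / 4"
      using * W_norm[OF *(3)] by (intro \<delta>(3)) auto
    moreover have "\<bar>pre_value s ?x ?y - limit_value p a ?x ?y\<bar> < \<epsilon> / 4"
      using * W_norm[OF *(3)] norm_ball by (intro s1(2)) auto
    ultimately have "pre_value s ?x ?y \<le> t + \<epsilon>" using W_norm[OF *(3)] by linarith
    then show "2 * a coord1 - pnorm_on UNIV p (z - w) \<le> s * (t + \<epsilon>)"
      unfolding pre_value_def using *(1) by (simp add: unscale_rescale divide_le_eq mult.commute)
  next
    fix x y
    assume *: "x \<in> paraboloid p a" "y \<in> paraboloid p a" "limit_value p a x y \<le> t"
    have "gap * (x $ coord1 + y $ coord1) \<le> t" using limit_value_ge[OF *(1,2)] * by linarith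
    then have "x $ coord1 + y $ coord1 \<le> t / gap" using gap_pos by (simp add: field_simps)
    then have "x \<in> K" "y \<in> K"
      using * paraboloid_coord1_nonneg[of x] paraboloid_coord1_nonneg[of y] by (auto simp: K_def)
    then show "\<exists>(c, c')\<in>W. x \<in> ball c \<delta> \<and> y \<in> ball c' \<delta>"
      using * assms by (intro cover) auto
  next
    fix x y c c'
    assume *: "(c, c') \<in> W" "x \<in> ball c \<delta>" "y \<in> ball c' \<delta>"
    then have "\<bar>limit_value p a x y - limit_value p a c c'\<bar> < \<epsilon> / 4"
      using W_norm[OF *(1)] by (intro \<delta>(3)) auto
    then show "limit_value p a x y \<le> t + \<epsilon>" using W_norm[OF *(1)] assms by linarith
  qed
qed

end

section \<open>Void probabilities\<close>

lemma occupancy_decomposition: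
  assumes "prob_space M" "finite I" and U: "\<And>i. i \<in> I \<Longrightarrow> U i \<in> sets M"
  shows "{\<omega> \<in> space M. {i \<in> I. \<omega> \<in> U i} = T} \<in> sets M"
    and "{\<omega> \<in> space M. Q {i \<in> I. \<omega> \<in> U i}} \<in> sets M"
    and "measure M {\<omega> \<in> space M. Q {i \<in> I. \<omega> \<in> U i}} =
      (\<Sum>T | T \<subseteq> I \<and> Q T. measure M {\<omega> \<in> space M. {i \<in> I. \<omega> \<in> U i} = T})"
proof -
  interpret prob_space M by fact
  have atom: "{\<omega> \<in> space M. {i \<in> I. \<omega> \<in> U i} = T} \<in> sets M" for T
  proof (cases "T \<subseteq> I")
    case True
    then have "{\<omega> \<in> space M. {i \<in> I. \<omega> \<in> U i} = T} = {\<omega> \<in> space M. \<forall>i\<in>I. if i \<in> T then \<omega> \<in> U i else \<omega> \<notin> U i}"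
      by (auto split: if_splits)
    also have "\<dots> \<in> sets M"
    proof (intro sets.sets_Collect_finite_All \<open>finite I\<close>)
      fix i assume [measurable]: "i \<in> I"
      note [measurable] = U[OF this]
      show "{\<omega> \<in> space M. if i \<in> T then \<omega> \<in> U i else \<omega> \<notin> U i} \<in> sets M" by measurable
    qed
    finally show ?thesis .
  next
    case False
    then have "{\<omega> \<in> space M. {i \<in> I. \<omega> \<in> U i} = T} = {}" by auto
    then show ?thesis by (simp only: sets.empty_sets)
  qed
  then show "{\<omega> \<in> space M. {i \<in> I. \<omega> \<in> U i} = T} \<in> sets M" .
  have fin: "finite {T. T \<subseteq> I \<and> Q T}" using \<open>finite I\<close> by (auto intro: finite_subset[of _ "Pow I"])
  have eq: "{\<omega> \<in> space M. Q {i \<in> I. \<omega> \<in> U i}} =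
      (\<Union>T\<in>{T. T \<subseteq> I \<and> Q T}. {\<omega> \<in> space M. {i \<in> I. \<omega> \<in> U i} = T})" by auto
  show "{\<omega> \<in> space M. Q {i \<in> I. \<omega> \<in> U i}} \<in> sets M"
    unfolding eq using fin atom by (intro sets.finite_UN) auto
  show "measure M {\<omega> \<in> space M. Q {i \<in> I. \<omega> \<in> U i}} =
      (\<Sum>T | T \<subseteq> I \<and> Q T. measure M {\<omega> \<in> space M. {i \<in> I. \<omega> \<in> U i} = T})"
    unfolding eq using fin atom
    by (intro finite_measure_finite_Union) (auto simp: disjoint_family_on_def)
qed

text \<open>The void event of \<open>I - T\<close> says that the occupied set is contained in
  \<open>T\<close>. Subtracting the atoms of the proper subsets leaves the atom of \<open>T\<close>,
  so atoms converge by induction on the cardinality, and the event given by \<open>Q\<close> is a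
  finite disjoint union of atoms.\<close>

lemma occupancy_convergence:
  fixes U :: "nat \<Rightarrow> 'i \<Rightarrow> 'w set" and V :: "'i \<Rightarrow> 'v set"
  assumes M: "prob_space M" "\<And>n i. i \<in> I \<Longrightarrow> U n i \<in> sets M"
    and M': "prob_space M'" "\<And>i. i \<in> I \<Longrightarrow> V i \<in> sets M'"
    and fin: "finite I"
    and void: "\<And>J. J \<subseteq> I \<Longrightarrow> (\<lambda>n. measure M {\<omega> \<in> space M. \<forall>i\<in>J. \<omega> \<notin> U n i}) \<longlonglongrightarrow>
       measure M' {\<omega> \<in> space M'. \<forall>i\<in>J. \<omega> \<notin> V i}"
  shows "(\<lambda>n. measure M {\<omega> \<in> space M. Q {i \<in> I. \<omega> \<in> U n i}}) \<longlonglongrightarrow>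
     measure M' {\<omega> \<in> space M'. Q {i \<in> I. \<omega> \<in> V i}}"
proof -
  define occ where "occ n T = measure M {\<omega> \<in> space M. {i \<in> I. \<omega> \<in> U n i} = T}" for n T
  define occ' where "occ' T = measure M' {\<omega> \<in> space M'. {i \<in> I. \<omega> \<in> V i} = T}" for T
  have "T \<subseteq> I \<Longrightarrow> (\<lambda>n. occ n T) \<longlonglongrightarrow> occ' T" for T
  proof (induction "card T" arbitrary: T rule: less_induct)
    case less
    have fT: "finite T" using less.prems fin finite_subset by auto
    have sub: "{S. S \<subseteq> I \<and> S \<subseteq> T} = insert T {S. S \<subset> T}" using less.prems by auto
    have fin': "finite {S. S \<subset> T}" using fT by (auto intro: finite_subset[of _ "Pow T"])
    have 1: "occ n T = measure M {\<omega> \<in> space M. \<forall>i\<in>I - T. \<omega> \<notin> U n i} - (\<Sum>S | S \<subset> T. occ n S)" for n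
    proof -
      have "{\<omega> \<in> space M. \<forall>i\<in>I - T. \<omega> \<notin> U n i} = {\<omega> \<in> space M. {i \<in> I. \<omega> \<in> U n i} \<subseteq> T}" by auto
      then have "measure M {\<omega> \<in> space M. \<forall>i\<in>I - T. \<omega> \<notin> U n i} = (\<Sum>S | S \<subseteq> I \<and> S \<subseteq> T. occ n S)"
        using occupancy_decomposition(3)[OF M(1) fin, where U = "U n" and Q = "\<lambda>S. S \<subseteq> T", OF M(2)] by (simp add: occ_def)
      then show ?thesis unfolding sub using fin' by simp
    qed
    have 2: "occ' T = measure M' {\<omega> \<in> space M'. \<forall>i\<in>I - T. \<omega> \<notin> V i} - (\<Sum>S | S \<subset> T. occ' S)"
    proof -
      have "{\<omega> \<in> space M'. \<forall>i\<in>I - T. \<omega> \<notin> V i} = {\<omega> \<in> space M'. {i \<in> I. \<omega> \<in> V i} \<subseteq> T}" by auto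
      then have "measure M' {\<omega> \<in> space M'. \<forall>i\<in>I - T. \<omega> \<notin> V i} = (\<Sum>S | S \<subseteq> I \<and> S \<subseteq> T. occ' S)"
        using occupancy_decomposition(3)[OF M'(1) fin, where U = V and Q = "\<lambda>S. S \<subseteq> T", OF M'(2)] by (simp add: occ'_def)
      then show ?thesis unfolding sub using fin' by simp
    qed
    show ?case
      unfolding 1 2 using less fT by (intro tendsto_diff tendsto_sum void less.hyps) (auto intro: psubset_card_mono)
  qed
  then have "(\<lambda>n. \<Sum>T | T \<subseteq> I \<and> Q T. occ n T) \<longlonglongrightarrow> (\<Sum>T | T \<subseteq> I \<and> Q T. occ' T)"
    by (intro tendsto_sum) auto
  then show ?thesis
    using occupancy_decomposition(3)[OF M(1) fin, where Q = Q, OF M(2)]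
      occupancy_decomposition(3)[OF M'(1) fin, where U = V and Q = Q, OF M'(2)]
    by (simp add: occ_def occ'_def)
qed

text \<open>The logarithm of \<open>1 - q n\<close> is exactly \<open>- q n\<close> times a slope
  that tends to \<open>1\<close>, which moves the product \<open>real (Suc n) * q n\<close> into the
  exponent.\<close>

lemma power_one_minus_tendsto_exp:
  fixes q :: "nat \<Rightarrow> real"
  assumes "(\<lambda>n. real (Suc n) * q n) \<longlonglongrightarrow> c"
  shows "(\<lambda>n. (1 - q n) ^ Suc n) \<longlonglongrightarrow> exp (- c)"
proof -
  have "(ln has_real_derivative 1) (at (1::real))" by (auto intro!: derivative_eq_intros)
  then obtain g :: "real \<Rightarrow> real" where g: "\<And>z. ln z - ln 1 = g z * (z - 1)" "isCont g 1" "g 1 = 1"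
    unfolding CARAT_DERIV by blast
  have "(\<lambda>n. (real (Suc n) * q n) * (1 / real (Suc n))) \<longlonglongrightarrow> c * 0"
    using LIMSEQ_inverse_real_of_nat by (intro tendsto_mult assms) (simp add: inverse_eq_divide)
  then have q0: "q \<longlonglongrightarrow> 0" by simp
  then have q1: "(\<lambda>n. 1 - q n) \<longlonglongrightarrow> 1" using tendsto_diff[OF tendsto_const q0, of 1] by simp
  have "(\<lambda>n. exp (- (g (1 - q n) * (real (Suc n) * q n)))) \<longlonglongrightarrow> exp (- (g 1 * c))"
    by (intro tendsto_exp tendsto_minus tendsto_mult assms isCont_tendsto_compose[OF g(2) q1])
  moreover have "\<forall>\<^sub>F n in sequentially. 0 < 1 - q n"
    using order_tendstoD(1)[OF q1, of 0] by simp
  then have "\<forall>\<^sub>F n in sequentially. exp (- (g (1 - q n) * (real (Suc n) * q n))) = (1 - q n) ^ Suc n"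
  proof eventually_elim
    case (elim n)
    have "ln (1 - q n) = - (g (1 - q n) * q n)" using g(1)[of "1 - q n"] by simp
    then have "- (g (1 - q n) * (real (Suc n) * q n)) = real (Suc n) * ln (1 - q n)"
      by (simp add: algebra_simps)
    then show ?case using elim by (simp only: exp_of_nat_mult exp_ln)
  qed
  ultimately show ?thesis by (simp add: g(3) tendsto_cong)
qed

section \<open>Void probabilities of samples and of Poisson processes\<close>

context prob_space
begin

lemma iid_void:
  fixes Z :: "nat \<Rightarrow> 'a \<Rightarrow> 'b::topological_space"
  assumes "indep_vars (\<lambda>_. borel) Z UNIV" "A \<in> sets borel"
    and q: "\<And>i. prob {\<omega> \<in> space M. Z i \<omega> \<in> A} = q"
  shows "prob {\<omega> \<in> space M. \<forall>i<m. Z i \<omega> \<notin> A} = (1 - q) ^ m"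
\<comment> \<open>For \<open>m = 0\<close> the intersection below would run over an empty index set;
  the event is then the whole space.\<close>
proof (cases "m = 0")
  case False
  have Z [measurable]: "random_variable borel (Z i)" for i
    using assms(1) by (auto simp: indep_vars_def)
  have c: "prob (Z i -` (- A) \<inter> space M) = 1 - q" for i
  proof -
    have "Z i -` (- A) \<inter> space M = space M - {\<omega> \<in> space M. Z i \<omega> \<in> A}" by auto
    then show ?thesis using assms(2) q[of i] prob_compl[of "{\<omega> \<in> space M. Z i \<omega> \<in> A}"] by simp
  qed
  have "prob (\<Inter>i\<in>{..<m}. Z i -` (- A) \<inter> space M) = (\<Prod>i\<in>{..<m}. prob (Z i -` (- A) \<inter> space M))"
    using assms False by (intro indep_varsD[OF assms(1)]) auto
  moreover have "(\<Inter>i\<in>{..<m}. Z i -` (- A) \<inter> space M) = {\<omega> \<in> space M. \<forall>i<m. Z i \<omega> \<notin> A}"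
    using False by auto
  ultimately show ?thesis by (simp add: c)
qed (simp add: prob_space)

text \<open>Splitting by the value of \<open>N\<close> turns the void probability into the
  generating function of the Poisson law at \<open>1 - q\<close>, so the exponential form is exact
  for every mean.\<close>

lemma poisson_mixture_void:
  fixes Z :: "nat \<Rightarrow> 'a \<Rightarrow> 'b::topological_space"
  assumes Z: "indep_vars (\<lambda>_. borel) Z UNIV" "A \<in> sets borel"
    and q: "\<And>i. prob {\<omega> \<in> space M. Z i \<omega> \<in> A} = q"
    and N [measurable]: "N \<in> M \<rightarrow>\<^sub>M count_space UNIV"
    and N_dist: "\<And>k. prob {\<omega> \<in> space M. N \<omega> = k} = l ^ k / fact k * exp (- l)"
    and indep: "indep_set (sets (vimage_algebra (space M) N (count_space UNIV)))
       (sets (vimage_algebra (space M) (\<lambda>\<omega> i. Z i \<omega>) (PiM UNIV (\<lambda>_. borel))))"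
  shows "prob {\<omega> \<in> space M. \<forall>i<N \<omega>. Z i \<omega> \<notin> A} = exp (- (l * q))"
proof -
  have Zm [measurable]: "random_variable borel (Z i)" for i
    using Z(1) by (auto simp: indep_vars_def)
  note [measurable] = Z(2)
  define B where "B k = {\<omega> \<in> space M. N \<omega> = k} \<inter> {\<omega> \<in> space M. \<forall>i<k. Z i \<omega> \<notin> A}" for k
  have Bm: "B k \<in> sets M" for k unfolding B_def by measurable
  have Bk: "prob (B k) = exp (- l) * ((l * (1 - q)) ^ k / fact k)" for k
  proof -
    have "{\<omega> \<in> space M. N \<omega> = k} \<in> sets (vimage_algebra (space M) N (count_space UNIV))"
    proof -
      have "N -` {k} \<inter> space M = {\<omega> \<in> space M. N \<omega> = k}" by auto
      then show ?thesis using in_vimage_algebra[of "{k}" "count_space UNIV" N "space M"] by simp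
    qed
    moreover have "{\<omega> \<in> space M. \<forall>i<k. Z i \<omega> \<notin> A} \<in>
        sets (vimage_algebra (space M) (\<lambda>\<omega> i. Z i \<omega>) (PiM UNIV (\<lambda>_. borel)))"
    proof -
      let ?S = "{z \<in> space (PiM UNIV (\<lambda>_. borel)). \<forall>i\<in>{..<k}. z i \<notin> A}"
      have S: "?S \<in> sets (PiM UNIV (\<lambda>_. borel))"
      proof (intro sets.sets_Collect_finite_All finite_lessThan)
        fix i
        have "(\<lambda>z. z i) -` (- A) \<inter> space (PiM UNIV (\<lambda>_. borel)) \<in> sets (PiM UNIV (\<lambda>_. borel))"
          using Z(2) by (intro measurable_sets[OF measurable_component_singleton]) auto
        then show "{z \<in> space (PiM UNIV (\<lambda>_. borel)). z i \<notin> A} \<in> sets (PiM UNIV (\<lambda>_. borel))"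
          by (simp add: vimage_def Int_def conj_commute)
      qed
      have eq: "(\<lambda>\<omega> i. Z i \<omega>) -` ?S \<inter> space M = {\<omega> \<in> space M. \<forall>i<k. Z i \<omega> \<notin> A}"
        by (auto simp: space_PiM)
      show ?thesis using in_vimage_algebra[OF S, of "\<lambda>\<omega> i. Z i \<omega>" "space M"] unfolding eq .
    qed
    ultimately have "prob (B k) = prob {\<omega> \<in> space M. N \<omega> = k} * prob {\<omega> \<in> space M. \<forall>i<k. Z i \<omega> \<notin> A}"
      unfolding B_def by (rule indep_setD[OF indep])
    then show ?thesis by (simp add: N_dist iid_void[OF Z q] power_mult_distrib)
  qed
  have B_Un: "{\<omega> \<in> space M. \<forall>i<N \<omega>. Z i \<omega> \<notin> A} = (\<Union>k. B k)" by (auto simp: B_def)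
  have sums_B: "(\<lambda>k. prob (B k)) sums prob (\<Union>k. B k)"
    using Bm by (intro finite_measure_UNION) (auto simp: disjoint_family_on_def B_def)
  have "(\<lambda>k. (l * (1 - q)) ^ k / fact k) sums exp (l * (1 - q))"
    using exp_converges[of "l * (1 - q)"] by (simp add: field_simps)
  then have "(\<lambda>k. prob (B k)) sums (exp (- l) * exp (l * (1 - q)))"
    unfolding Bk by (intro sums_mult)
  then have "prob {\<omega> \<in> space M. \<forall>i<N \<omega>. Z i \<omega> \<notin> A} = exp (- l) * exp (l * (1 - q))"
    unfolding B_Un by (rule sums_unique2[OF sums_B])
  also have "\<dots> = exp (- (l * q))"
    by (simp only: exp_add[symmetric]) (simp add: algebra_simps)
  finally show ?thesis .
qed

lemma num_points_eq_0: "num_points X B \<omega> = 0 \<longleftrightarrow> (\<forall>i. X i \<omega> \<notin> B)"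
  by (cases "finite {i. X i \<omega> \<in> B}")
     (auto simp: num_points_def emeasure_count_space dest: infinite_imp_nonempty)

lemma poisson_process_void:
  assumes "poisson_process \<mu> X" and A: "A \<in> sets \<mu>" "emeasure \<mu> A \<noteq> \<infinity>"
  shows "prob {\<omega> \<in> space M. num_points X A \<omega> = 0} = exp (- measure \<mu> A)"
proof -
  have "\<forall>k::nat. prob {\<omega> \<in> space M. num_points X A \<omega> = of_nat k} =
       (if emeasure \<mu> A = \<infinity> then 0 else exp (- measure \<mu> A) * measure \<mu> A ^ k / fact k)"
    using assms unfolding poisson_process_def by blast
  from spec[OF this, of 0] show ?thesis using A(2) by simp
qed

text \<open>Independence is assumed for the whole families of counts; evaluating them at
  \<open>A\<close> and \<open>B\<close> leaves two independent counts that must both vanish.\<close>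

lemma poisson_processes_void:
  assumes "poisson_process \<mu> X" "poisson_process \<nu> Y" "indep_processes \<mu> X \<nu> Y"
    and A: "A \<in> sets \<mu>" "emeasure \<mu> A \<noteq> \<infinity>" and B: "B \<in> sets \<nu>" "emeasure \<nu> B \<noteq> \<infinity>"
  shows "prob {\<omega> \<in> space M. (\<forall>i. X i \<omega> \<notin> A) \<and> (\<forall>j. Y j \<omega> \<notin> B)} = exp (- (measure \<mu> A + measure \<nu> B))"
proof -
  have single: "prob {\<omega> \<in> space M. num_points X A \<omega> = 0} = exp (- measure \<mu> A)"
    "prob {\<omega> \<in> space M. num_points Y B \<omega> = 0} = exp (- measure \<nu> B)"
    using assms by (auto intro: poisson_process_void)
  have "indep_var borel ((\<lambda>c. c A) \<circ> (\<lambda>\<omega>. \<lambda>B\<in>sets \<mu>. num_points X B \<omega>))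
                  borel ((\<lambda>c. c B) \<circ> (\<lambda>\<omega>. \<lambda>B\<in>sets \<nu>. num_points Y B \<omega>))"
    using assms by (intro indep_var_compose[OF assms(3)[unfolded indep_processes_def]]) auto
  then have ind: "indep_var borel (num_points X A) borel (num_points Y B)"
    using A B by (simp add: comp_def)
  have "prob {\<omega> \<in> space M. (\<forall>i. X i \<omega> \<notin> A) \<and> (\<forall>j. Y j \<omega> \<notin> B)} =
      prob ((\<lambda>\<omega>. (num_points X A \<omega>, num_points Y B \<omega>)) -` ({0} \<times> {0}) \<inter> space M)"
    by (intro arg_cong[where f = prob]) (auto simp flip: num_points_eq_0)
  also have "\<dots> = prob (num_points X A -` {0} \<inter> space M) * prob (num_points Y B -` {0} \<inter> space M)"
    by (rule indep_varD[OF ind]) auto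
  also have "\<dots> = exp (- measure \<mu> A) * exp (- measure \<nu> B)"
    unfolding single[symmetric] by (simp add: vimage_def Int_def conj_commute)
  finally show ?thesis by (simp add: exp_add[symmetric])
qed

text \<open>The probabilities of the finite counts form a full exponential series and sum to
  \<open>1\<close>, so an infinite count has probability \<open>0\<close>.\<close>

lemma poisson_process_AE_finite:
  assumes X: "poisson_process \<mu> X" and A: "A \<in> sets \<mu>" "emeasure \<mu> A \<noteq> \<infinity>"
  shows "AE \<omega> in M. finite {i. X i \<omega> \<in> A}"
proof -
  have Xm [measurable]: "X i \<in> M \<rightarrow>\<^sub>M \<mu>" for i using X by (auto simp: poisson_process_def)
  note [measurable] = A(1)
  have np: "num_points X A \<in> borel_measurable M"
  proof -
    \<comment> \<open>As a series of indicators the count is measurable, so its level sets are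
      events.\<close>
    have "num_points X A = (\<lambda>\<omega>. \<Sum>i. indicator A (X i \<omega>))"
    proof
      fix \<omega>
      have "num_points X A \<omega> = (\<integral>\<^sup>+ i. indicator {i. X i \<omega> \<in> A} i \<partial>count_space UNIV)"
        by (simp add: num_points_def)
      also have "\<dots> = (\<Sum>i. indicator {i. X i \<omega> \<in> A} i)" by (rule nn_integral_count_space_nat)
      finally show "num_points X A \<omega> = (\<Sum>i. indicator A (X i \<omega>))" by (simp add: indicator_def)
    qed
    then show ?thesis by simp
  qed
  note [measurable] = np
  define B where "B k = {\<omega> \<in> space M. num_points X A \<omega> = of_nat k}" for k :: nat
  have Bm: "B k \<in> sets M" for k unfolding B_def by measurable
  have Bk: "prob (B k) = exp (- measure \<mu> A) * (measure \<mu> A ^ k / fact k)" for k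
    using X A unfolding poisson_process_def B_def by simp
  have sums_B: "(\<lambda>k. prob (B k)) sums prob (\<Union>k. B k)"
    using Bm by (intro finite_measure_UNION) (auto simp: disjoint_family_on_def B_def)
  have "(\<lambda>k. prob (B k)) sums (exp (- measure \<mu> A) * exp (measure \<mu> A))"
    unfolding Bk using exp_converges[of "measure \<mu> A"] by (intro sums_mult) (simp add: field_simps)
  then have "prob (\<Union>k. B k) = exp (- measure \<mu> A) * exp (measure \<mu> A)"
    by (rule sums_unique2[OF sums_B])
  then have "prob (\<Union>k. B k) = 1" by (simp flip: exp_add)
  then have "AE \<omega> in M. \<omega> \<in> (\<Union>k. B k)"
    using Bm by (subst (asm) prob_eq_1) auto
  then show ?thesis
  proof eventually_elim
    case (elim \<omega>)
    then obtain k :: nat where "num_points X A \<omega> = of_nat k" by (auto simp: B_def)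
    then show ?case by (auto simp: num_points_def emeasure_count_space split: if_splits)
  qed
qed

lemma poisson_process_AE_not_in:
  assumes X: "poisson_process \<mu> X" and A: "A \<in> sets \<mu>" "emeasure \<mu> A = 0"
  shows "AE \<omega> in M. \<forall>i. X i \<omega> \<notin> A"
proof -
  have Xm [measurable]: "X i \<in> M \<rightarrow>\<^sub>M \<mu>" for i using X by (auto simp: poisson_process_def)
  note [measurable] = A(1)
  have m: "{\<omega> \<in> space M. \<forall>i. X i \<omega> \<notin> A} \<in> sets M" by measurable
  have "measure \<mu> A = 0" using A by (simp add: measure_def)
  moreover have "prob {\<omega> \<in> space M. num_points X A \<omega> = 0} = exp (- measure \<mu> A)"
    using X A by (intro poisson_process_void) auto
  ultimately have "prob {\<omega> \<in> space M. \<forall>i. X i \<omega> \<notin> A} = 1"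
    by (simp add: num_points_eq_0)
  then show ?thesis using m by (subst (asm) prob_eq_1) auto
qed

end

section \<open>Convergence in distribution\<close>

lemma pdiam_attained:
  assumes "0 < m"
  shows "\<exists>i<m. \<exists>j<m. pdiam p m z = pnorm_on UNIV p (z i - z j)"
proof -
  let ?S = "{pnorm_on UNIV p (z i - z j) | i j. i < m \<and> j < m}"
  have "finite ?S" by (intro finite_image_set2) auto
  moreover have "?S \<noteq> {}" using assms by auto
  ultimately have "Max ?S \<in> ?S" by (rule Max_in)
  then show ?thesis using assms by (auto simp: pdiam_def)
qed

lemma pdiam_ge:
  assumes "i < m" "j < m"
  shows "pnorm_on UNIV p (z i - z j) \<le> pdiam p m z"
proof -
  have "finite {pnorm_on UNIV p (z i - z j) | i j. i < m \<and> j < m}" by (intro finite_image_set2) auto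
  then show ?thesis using assms by (auto simp: pdiam_def intro!: Max_ge)
qed

text \<open>The sample size is random but takes countably many values, so measurability for each
  fixed \<open>m\<close> suffices.\<close>

lemma measurable_pdiam:
  fixes Z :: "nat \<Rightarrow> 'w \<Rightarrow> real ^ 'n"
  assumes [measurable]: "\<And>i. Z i \<in> borel_measurable M" "N \<in> M \<rightarrow>\<^sub>M count_space UNIV"
  shows "(\<lambda>\<omega>. pdiam p (N \<omega>) (\<lambda>i. Z i \<omega>)) \<in> borel_measurable M"
proof (rule measurable_compose_countable[where g = N])
  fix m :: nat
  have [measurable]: "(\<lambda>z :: real ^ 'n. z $ k) \<in> borel_measurable borel" for k
    by (intro borel_measurable_continuous_onI continuous_intros)
  have "{pnorm_on UNIV p (Z i \<omega> - Z j \<omega>) | i j. i < m \<and> j < m} =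
      (\<lambda>(i, j). pnorm_on UNIV p (Z i \<omega> - Z j \<omega>)) ` ({..<m} \<times> {..<m})" for \<omega>
    by auto
  then show "(\<lambda>\<omega>. pdiam p m (\<lambda>i. Z i \<omega>)) \<in> borel_measurable M"
    unfolding pdiam_def pnorm_on_def by (cases "m = 0") (auto simp: case_prod_unfold)
qed (rule assms)

text \<open>The numbers \<open>b n\<close> and \<open>b'\<close> stand for probabilities of
  intermediate events whose convergence is known. The slack \<open>\<epsilon>\<close> disappears at
  a continuity point of the limiting distribution function.\<close>

lemma weak_conv_m_sandwich:
  fixes D :: "nat \<Rightarrow> 'w \<Rightarrow> real" and T :: "'v \<Rightarrow> real"
  assumes M: "prob_space M" "\<And>n. D n \<in> borel_measurable M"
    and M': "prob_space M'" "T \<in> borel_measurable M'"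
    and sandwich: "\<And>t \<epsilon>. 0 < \<epsilon> \<Longrightarrow> \<exists>b b'. b \<longlonglongrightarrow> b' \<and>
      (\<forall>\<^sub>F n in sequentially. measure M {\<omega> \<in> space M. D n \<omega> \<le> t} \<le> b n \<and>
         b n \<le> measure M {\<omega> \<in> space M. D n \<omega> \<le> t + \<epsilon>}) \<and>
      measure M' {\<omega> \<in> space M'. T \<omega> \<le> t} \<le> b' \<and> b' \<le> measure M' {\<omega> \<in> space M'. T \<omega> \<le> t + \<epsilon>}"
  shows "weak_conv_m (\<lambda>n. distr M borel (D n)) (distr M' borel T)"
proof -
  define F where "F x = measure M' {\<omega> \<in> space M'. T \<omega> \<le> x}" for x
  define G where "G n x = measure M {\<omega> \<in> space M. D n \<omega> \<le> x}" for n x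
  have F: "cdf (distr M' borel T) = F"
    using M'(2) by (auto simp: fun_eq_iff cdf_def F_def measure_distr vimage_def Int_def conj_commute)
  have G: "cdf (distr M borel (D n)) = G n" for n
    using M(2)[of n] by (auto simp: fun_eq_iff cdf_def G_def measure_distr vimage_def Int_def conj_commute)
  have "(\<lambda>n. G n x) \<longlonglongrightarrow> F x" if cont: "isCont F x" for x
  proof (rule order_tendstoI)
    fix c assume c: "c < F x"
    have "\<forall>\<^sub>F y in nhds x. c < F y"
      using order_tendstoD(1)[OF cont[unfolded isCont_def tendsto_at_iff_tendsto_nhds] c] .
    then obtain d where d: "d > 0" "\<And>y. dist y x < d \<Longrightarrow> c < F y" unfolding eventually_nhds_metric by blast
    \<comment> \<open>For the lower estimate the slack has to end at \<open>x\<close>, hence the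
      start at \<open>x - d / 2\<close>; the upper estimate starts at \<open>x\<close>
      itself.\<close>
    obtain b b' where b: "b \<longlonglongrightarrow> b'" "\<forall>\<^sub>F n in sequentially. b n \<le> G n (x - d / 2 + d / 2)" "F (x - d / 2) \<le> b'"
      using sandwich[of "d / 2" "x - d / 2"] d(1) unfolding F_def G_def
      by (auto simp: eventually_conj_iff simp del: diff_add_cancel)
    have "c < F (x - d / 2)" using d by (intro d(2)) (auto simp: dist_real_def)
    then have "c < b'" using b by linarith
    from order_tendstoD(1)[OF b(1) this] b(2) show "\<forall>\<^sub>F n in sequentially. c < G n x"
      by eventually_elim simp
  next
    fix c assume c: "F x < c"
    have "\<forall>\<^sub>F y in nhds x. F y < c"
      using order_tendstoD(2)[OF cont[unfolded isCont_def tendsto_at_iff_tendsto_nhds] c] .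
    then obtain d where d: "d > 0" "\<And>y. dist y x < d \<Longrightarrow> F y < c" unfolding eventually_nhds_metric by blast
    obtain b b' where b: "b \<longlonglongrightarrow> b'" "\<forall>\<^sub>F n in sequentially. G n x \<le> b n" "b' \<le> F (x + d / 2)"
      using sandwich[of "d / 2" x] d(1) unfolding F_def G_def by (auto simp: eventually_conj_iff)
    have "F (x + d / 2) < c" using d by (intro d(2)) (auto simp: dist_real_def)
    then have "b' < c" using b by linarith
    from order_tendstoD(2)[OF b(1) this] b(2) show "\<forall>\<^sub>F n in sequentially. G n x < c"
      by eventually_elim simp
  qed
  then show ?thesis by (simp add: weak_conv_m_def weak_conv_def F G)
qed

section \<open>From void probabilities to the limit law\<close>

context elliptic_ball
begin

text \<open>Once \<open>s k\<close> times a common radius of \<open>C\<close> and \<open>C'\<close>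
  is below \<open>a coord1\<close>, the two preimages lie in opposite half-spaces, so the integral
  over their union is the sum of the contributions of the two poles.\<close>

lemma void_rate:
  assumes C: "bounded C" "C \<in> sets borel" and C': "bounded C'" "C' \<in> sets borel"
    and s: "s \<longlonglongrightarrow> 0" "\<And>k::nat. 0 < s k"
    and f: "set_integrable lebesgue (ellipsoid p a) f"
    and cont: "continuous (at (axis coord1 (- a coord1)) within ellipsoid p a) f"
      "continuous (at (axis coord1 (a coord1)) within ellipsoid p a) f"
  shows "(\<lambda>k. (LINT z:ellipsoid p a \<inter> {z. rescale (-1) (s k) z \<in> C \<or> rescale 1 (s k) z \<in> C'}|lebesgue. f z) / slice_vol (s k))
    \<longlonglongrightarrow> f (axis coord1 (- a coord1)) * measure lebesgue (C \<inter> paraboloid p a) +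
        f (axis coord1 (a coord1)) * measure lebesgue (C' \<inter> paraboloid p a)"
proof -
  let ?D = "\<lambda>k. {z \<in> ellipsoid p a. rescale (-1) (s k) z \<in> C}"
  let ?D' = "\<lambda>k. {z \<in> ellipsoid p a. rescale 1 (s k) z \<in> C'}"
  obtain L where L: "\<And>x. x \<in> C \<Longrightarrow> norm x \<le> L" using C(1) by (auto simp: bounded_iff)
  obtain L' where L': "\<And>x. x \<in> C' \<Longrightarrow> norm x \<le> L'" using C'(1) by (auto simp: bounded_iff)
  have "(\<lambda>k. (LINT z:?D k|lebesgue. f z) / slice_vol (s k) + (LINT z:?D' k|lebesgue. f z) / slice_vol (s k))
     \<longlonglongrightarrow> f (axis coord1 (- a coord1)) * measure lebesgue (C \<inter> paraboloid p a) +
        f (axis coord1 (a coord1)) * measure lebesgue (C' \<inter> paraboloid p a)"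
    using integral_near_pole[OF C _ s f, of "-1"] integral_near_pole[OF C' _ s f, of 1] cont
    by (intro tendsto_add) auto
  moreover have "\<forall>\<^sub>F k in sequentially. \<bar>s k\<bar> * (max L L' + 1) < a coord1"
  proof -
    have "(\<lambda>k. \<bar>s k\<bar> * (max L L' + 1)) \<longlonglongrightarrow> \<bar>0\<bar> * (max L L' + 1)" by (intro tendsto_intros s)
    then show ?thesis using a_pos[of coord1] by (intro order_tendstoD) auto
  qed
  then have "\<forall>\<^sub>F k in sequentially.
      (LINT z:?D k|lebesgue. f z) / slice_vol (s k) + (LINT z:?D' k|lebesgue. f z) / slice_vol (s k) =
      (LINT z:ellipsoid p a \<inter> {z. rescale (-1) (s k) z \<in> C \<or> rescale 1 (s k) z \<in> C'}|lebesgue. f z) / slice_vol (s k)"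
  proof eventually_elim
    case (elim k)
    have "z $ coord1 < 0" if "rescale (-1) (s k) z \<in> C" for z
    proof -
      have "rescale (-1) (s k) z $ coord1 = (a coord1 + z $ coord1) / s k" by (simp add: rescale_def)
      then have "(a coord1 + z $ coord1) / s k \<le> L"
        using L[OF that] component_le_norm_cart[of "rescale (-1) (s k) z" coord1] by linarith
      then have "a coord1 + z $ coord1 \<le> s k * L" using s(2)[of k] by (simp add: divide_le_eq mult.commute)
      also have "\<dots> \<le> \<bar>s k\<bar> * (max L L' + 1)" using s(2)[of k] by (simp only: abs_of_pos) (intro mult_left_mono, auto)
      finally show ?thesis using elim by linarith
    qed
    moreover have "0 < z $ coord1" if "rescale 1 (s k) z \<in> C'" for z
    proof -
      have "rescale 1 (s k) z $ coord1 = (a coord1 - z $ coord1) / s k" by (simp add: rescale_def)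
      then have "(a coord1 - z $ coord1) / s k \<le> L'"
        using L'[OF that] component_le_norm_cart[of "rescale 1 (s k) z" coord1] by linarith
      then have "a coord1 - z $ coord1 \<le> s k * L'" using s(2)[of k] by (simp add: divide_le_eq mult.commute)
      also have "\<dots> \<le> \<bar>s k\<bar> * (max L L' + 1)" using s(2)[of k] by (simp only: abs_of_pos) (intro mult_left_mono, auto)
      finally show ?thesis using elim by linarith
    qed
    ultimately have disj: "?D k \<inter> ?D' k = {}" by force
    have "set_integrable lebesgue (?D k) f" "set_integrable lebesgue (?D' k) f"
      using measure_rescale_vimage(1)[OF C _ s(2), of "-1"] measure_rescale_vimage(1)[OF C' _ s(2), of 1]
      by (auto intro!: set_integrable_subset[OF f])
    from set_integral_Un[OF disj this]
    have "(LINT z:?D k \<union> ?D' k|lebesgue. f z) = (LINT z:?D k|lebesgue. f z) + (LINT z:?D' k|lebesgue. f z)" .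
    moreover have "?D k \<union> ?D' k = ellipsoid p a \<inter> {z. rescale (-1) (s k) z \<in> C \<or> rescale 1 (s k) z \<in> C'}"
      by auto
    ultimately show ?case by (simp add: add_divide_distrib)
  qed
  ultimately show ?thesis by (rule Lim_transform_eventually)
qed

text \<open>By \<open>limit_value_ge\<close>, a pair whose value does not exceed that of the pair
  \<open>(0, 0)\<close> has both points in a fixed cap, and such pairs are finitely many.\<close>

lemma minimum_attained:
  fixes x y :: "nat \<Rightarrow> real ^ 'n::{finite,linorder}"
  assumes "\<And>i. x i \<in> paraboloid p a" "\<And>j. y j \<in> paraboloid p a"
    and "\<And>R::nat. finite {i. x i $ coord1 \<le> real R}" "\<And>R::nat. finite {j. y j $ coord1 \<le> real R}"
  shows "\<exists>i j. \<forall>i' j'. limit_value p a (x i) (y j) \<le> limit_value p a (x i') (y j')"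
proof -
  define t where "t = limit_value p a (x 0) (y 0)"
  define S where "S = {(i, j). limit_value p a (x i) (y j) \<le> t}"
  \<comment> \<open>Natural radii keep the finiteness assumptions countable in number, so that
    almost surely all of them hold at once.\<close>
  obtain R :: nat where R: "t / gap \<le> real R" using real_arch_simple by blast
  have "x i $ coord1 \<le> real R \<and> y j $ coord1 \<le> real R" if "(i, j) \<in> S" for i j
  proof -
    have "gap * (x i $ coord1 + y j $ coord1) \<le> t"
      using limit_value_ge[OF assms(1,2)] that by (auto simp: S_def intro: order_trans)
    then have "x i $ coord1 + y j $ coord1 \<le> t / gap" using gap_pos by (simp add: field_simps)
    then show ?thesis
      using R paraboloid_coord1_nonneg[OF assms(1), of i] paraboloid_coord1_nonneg[OF assms(2), of j] by linarith
  qed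
  then have "S \<subseteq> {i. x i $ coord1 \<le> real R} \<times> {j. y j $ coord1 \<le> real R}" by auto
  then have "finite S" using assms(3,4) finite_subset by blast
  moreover have "(0, 0) \<in> S" by (simp add: S_def t_def)
  ultimately obtain m where "is_arg_min (\<lambda>(i, j). limit_value p a (x i) (y j)) (\<lambda>m. m \<in> S) m"
    using ex_is_arg_min_if_finite[of S] by blast
  then obtain i j where m: "(i, j) \<in> S"
    "\<And>i' j'. (i', j') \<in> S \<Longrightarrow> \<not> limit_value p a (x i') (y j') < limit_value p a (x i) (y j)"
    by (cases m) (auto simp: is_arg_min_def)
  have "limit_value p a (x i) (y j) \<le> limit_value p a (x i') (y j')" for i' j'
    using m(1) m(2)[of i' j'] by (cases "(i', j') \<in> S") (auto simp: S_def)
  then show ?thesis by blast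
qed

lemma dim_pos: "0 < real CARD('n) + p - 1"
proof -
  have "1 \<le> real CARD('n)" by (simp add: Suc_leI)
  then show ?thesis using p by linarith
qed

text \<open>This identity fixes the exponent of \<open>n\<close>: a bounded rescaled region at a
  pole receives a mean number of sample points of order one.\<close>

lemma slice_vol_powr:
  assumes "0 < x"
  shows "slice_vol (x powr - (p / (real CARD('n) + p - 1))) = 1 / x"
proof -
  have "- (p / (real CARD('n) + p - 1)) * ((real CARD('n) + p - 1) / p) = - 1"
    using p dim_pos by simp
  then show ?thesis unfolding slice_vol_def powr_powr using assms by (simp add: powr_minus_divide)
qed

text \<open>The sample size \<open>K n\<close> and the hypothesis \<open>void\<close> are left
  abstract, so that the Poissonized sample and the sample of fixed size are both instances. On the
  limit side, too, the Poisson processes enter through void probabilities and almost sure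
  properties.\<close>

lemma diameter_weak_limit:
  fixes Z :: "nat \<Rightarrow> 'w \<Rightarrow> real ^ 'n::{finite,linorder}" and K :: "nat \<Rightarrow> 'w \<Rightarrow> nat"
    and X Y :: "nat \<Rightarrow> 'v \<Rightarrow> real ^ 'n::{finite,linorder}"
  defines "\<gamma> \<equiv> p / (real CARD('n) + p - 1)"
    and "T \<equiv> \<lambda>\<omega>. INF (i, j)\<in>UNIV. limit_value p a (X i \<omega>) (Y j \<omega>)"
  assumes M: "prob_space M"
    and Z [measurable]: "\<And>i. Z i \<in> borel_measurable M"
    and K [measurable]: "\<And>n. K n \<in> M \<rightarrow>\<^sub>M count_space UNIV"
    and dens: "\<And>i B. B \<in> sets borel \<Longrightarrow>
      measure M {\<omega> \<in> space M. Z i \<omega> \<in> B} = (LINT z:ellipsoid p a \<inter> B|lebesgue. f z)"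
    and f: "set_integrable lebesgue (ellipsoid p a) f"
    and cont: "continuous (at (axis coord1 (- a coord1)) within ellipsoid p a) f"
      "continuous (at (axis coord1 (a coord1)) within ellipsoid p a) f"
    and void: "\<And>A c. (\<And>n. A n \<in> sets borel) \<Longrightarrow>
      (\<lambda>n. real (Suc n) * measure M {\<omega> \<in> space M. Z 0 \<omega> \<in> A n}) \<longlonglongrightarrow> c \<Longrightarrow>
      (\<lambda>n. measure M {\<omega> \<in> space M. \<forall>i<K n \<omega>. Z i \<omega> \<notin> A n}) \<longlonglongrightarrow> exp (- c)"
    and M': "prob_space M'"
    and X [measurable]: "\<And>i. X i \<in> borel_measurable M'" and Y [measurable]: "\<And>i. Y i \<in> borel_measurable M'"
    and void': "\<And>A B. bounded A \<Longrightarrow> A \<in> sets borel \<Longrightarrow> bounded B \<Longrightarrow> B \<in> sets borel \<Longrightarrow>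
      measure M' {\<omega> \<in> space M'. (\<forall>i. X i \<omega> \<notin> A) \<and> (\<forall>j. Y j \<omega> \<notin> B)} =
      exp (- (f (axis coord1 (- a coord1)) * measure lebesgue (A \<inter> paraboloid p a) +
              f (axis coord1 (a coord1)) * measure lebesgue (B \<inter> paraboloid p a)))"
    and XY_in: "AE \<omega> in M'. \<forall>i. X i \<omega> \<in> paraboloid p a" "AE \<omega> in M'. \<forall>j. Y j \<omega> \<in> paraboloid p a"
    and attained: "AE \<omega> in M'. \<exists>i j. \<forall>i' j'.
      limit_value p a (X i \<omega>) (Y j \<omega>) \<le> limit_value p a (X i' \<omega>) (Y j' \<omega>)"
    and T [measurable]: "T \<in> borel_measurable M'"
  shows "weak_conv_m
    (\<lambda>n. distr M borel (\<lambda>\<omega>. real (Suc n) powr \<gamma> * (2 * a coord1 - pdiam p (K n \<omega>) (\<lambda>i. Z i \<omega>))))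
    (distr M' borel T)"
proof (rule weak_conv_m_sandwich[OF M _ M' T])
  interpret M: prob_space M by fact
  interpret M': prob_space M' by fact
  note measurable_pdiam[measurable]
  define D where "D n \<omega> = real (Suc n) powr \<gamma> * (2 * a coord1 - pdiam p (K n \<omega>) (\<lambda>i. Z i \<omega>))" for n \<omega>
  have D [measurable]: "D n \<in> borel_measurable M" for n unfolding D_def by measurable
  then show "(\<lambda>\<omega>. real (Suc n) powr \<gamma> * (2 * a coord1 - pdiam p (K n \<omega>) (\<lambda>i. Z i \<omega>))) \<in> borel_measurable M" for n
    by (simp add: D_def[abs_def])
  define s where "s n = real (Suc n) powr - \<gamma>" for n
  have s_pos: "0 < s n" for n by (simp add: s_def)
  have \<gamma>: "0 < \<gamma>" using p dim_pos by (simp add: \<gamma>_def)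
  have s_lim: "s \<longlonglongrightarrow> 0"
    unfolding s_def using \<gamma>
    by (intro tendsto_neg_powr filterlim_compose[OF filterlim_real_sequentially filterlim_Suc]) auto
  have D_le: "D n \<omega> \<le> t \<longleftrightarrow> 2 * a coord1 - pdiam p (K n \<omega>) (\<lambda>i. Z i \<omega>) \<le> s n * t" for n \<omega> t
    by (simp add: D_def s_def powr_minus field_simps)
  have "AE \<omega> in M. Z i \<omega> \<in> ellipsoid p a" for i
  proof -
    have [measurable]: "ellipsoid p a \<in> sets borel" using closed_ellipsoid by auto
    have "M.prob {\<omega> \<in> space M. Z i \<omega> \<in> - ellipsoid p a} = 0"
      by (subst dens) (auto simp: set_lebesgue_integral_def)
    moreover have "{\<omega> \<in> space M. Z i \<omega> \<in> - ellipsoid p a} \<in> sets M" by measurable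
    ultimately have "AE \<omega> in M. \<omega> \<notin> {\<omega> \<in> space M. Z i \<omega> \<in> - ellipsoid p a}" by (subst (asm) M.prob_eq_0)
    then show ?thesis by (auto elim: AE_mp)
  qed
  then have Z_in: "AE \<omega> in M. \<forall>i. Z i \<omega> \<in> ellipsoid p a" by (simp add: AE_all_countable)
  \<comment> \<open>Attainment turns an infimum of at most \<open>t\<close> into an actual pair of
    value at most \<open>t\<close>; a bare infimum might only be approached.\<close>
  have T_le: "AE \<omega> in M'. T \<omega> \<le> t \<longleftrightarrow> (\<exists>i j. limit_value p a (X i \<omega>) (Y j \<omega>) \<le> t)" for t
    using attained
  proof eventually_elim
    case (elim \<omega>)
    then obtain i j where ij: "\<And>i' j'. limit_value p a (X i \<omega>) (Y j \<omega>) \<le> limit_value p a (X i' \<omega>) (Y j' \<omega>)"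
      by blast
    have "T \<omega> = limit_value p a (X i \<omega>) (Y j \<omega>)"
      unfolding T_def by (rule cInf_eq_minimum) (use ij in auto)
    then show ?case using ij order_trans by metis
  qed
  fix t \<epsilon> :: real assume "0 < \<epsilon>"
  then obtain W \<delta> s0 where W: "finite W" "0 < \<delta>" "0 < s0"
    "\<And>s z w. 0 < s \<Longrightarrow> s < s0 \<Longrightarrow> z \<in> ellipsoid p a \<Longrightarrow> w \<in> ellipsoid p a \<Longrightarrow>
      2 * a coord1 - pnorm_on UNIV p (z - w) \<le> s * t \<Longrightarrow>
      \<exists>(c, c')\<in>W. rescale (-1) s z \<in> ball c \<delta> \<and> rescale 1 s w \<in> ball c' \<delta> \<or>
                 rescale (-1) s w \<in> ball c \<delta> \<and> rescale 1 s z \<in> ball c' \<delta>"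
    "\<And>s z w c c'. 0 < s \<Longrightarrow> s < s0 \<Longrightarrow> (c, c') \<in> W \<Longrightarrow> rescale (-1) s z \<in> ball c \<delta> \<Longrightarrow>
      rescale 1 s w \<in> ball c' \<delta> \<Longrightarrow> 2 * a coord1 - pnorm_on UNIV p (z - w) \<le> s * (t + \<epsilon>)"
    "\<And>x y. x \<in> paraboloid p a \<Longrightarrow> y \<in> paraboloid p a \<Longrightarrow> limit_value p a x y \<le> t \<Longrightarrow>
      \<exists>(c, c')\<in>W. x \<in> ball c \<delta> \<and> y \<in> ball c' \<delta>"
    "\<And>x y c c'. (c, c') \<in> W \<Longrightarrow> x \<in> ball c \<delta> \<Longrightarrow> y \<in> ball c' \<delta> \<Longrightarrow> limit_value p a x y \<le> t + \<epsilon>"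
    using discretisation[of \<epsilon> t] by blast
  \<comment> \<open>The sign attaches a centre to a pole, since one centre may occur at
    both.\<close>
  define I where "I = (fst ` W \<union> snd ` W) \<times> {-1, 1 :: real}"
  define U where "U n i = {\<omega> \<in> space M. \<exists>k<K n \<omega>. rescale (snd i) (s n) (Z k \<omega>) \<in> ball (fst i) \<delta>}" for n i
  define V where "V i = {\<omega> \<in> space M'. \<exists>k. (if snd i = -1 then X k \<omega> else Y k \<omega>) \<in> ball (fst i) \<delta>}"
    for i :: "(real ^ 'n::{finite,linorder}) \<times> real"
  define Q where "Q S = (\<exists>(c, c')\<in>W. (c, -1) \<in> S \<and> (c', 1) \<in> S)"
    for S :: "((real ^ 'n::{finite,linorder}) \<times> real) set"
  have finI: "finite I" using W(1) by (simp add: I_def)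
  have U: "U n i \<in> sets M" for n i
  proof -
    have "U n i = (\<Union>k. (K n -` {k<..} \<inter> space M) \<inter> (Z k -` {z. rescale (snd i) (s n) z \<in> ball (fst i) \<delta>} \<inter> space M))"
      by (auto simp: U_def)
    also have "\<dots> \<in> sets M"
      by (intro sets.countable_UN sets.Int image_subsetI measurable_sets[OF K] measurable_sets[OF Z] sets_rescale_vimage s_pos)
        auto
    finally show ?thesis .
  qed
  have V [measurable]: "V i \<in> sets M'" for i
    unfolding V_def by (cases "snd i = -1") simp_all
  have Q_U: "Q {i \<in> I. \<omega> \<in> U n i} \<longleftrightarrow> (\<exists>(c, c')\<in>W. \<omega> \<in> U n (c, -1) \<and> \<omega> \<in> U n (c', 1))" for n \<omega>
    unfolding Q_def I_def by force
  have Q_V: "Q {i \<in> I. \<omega> \<in> V i} \<longleftrightarrow> (\<exists>(c, c')\<in>W. \<omega> \<in> V (c, -1) \<and> \<omega> \<in> V (c', 1))" for \<omega>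
    unfolding Q_def I_def by force
  have QU_sets: "{\<omega> \<in> space M. Q {i \<in> I. \<omega> \<in> U n i}} \<in> sets M" for n
    by (rule occupancy_decomposition(2)[OF M finI U])
  have QV_sets: "{\<omega> \<in> space M'. Q {i \<in> I. \<omega> \<in> V i}} \<in> sets M'"
    by (rule occupancy_decomposition(2)[OF M' finI V])
  have conv: "(\<lambda>n. M.prob {\<omega> \<in> space M. Q {i \<in> I. \<omega> \<in> U n i}}) \<longlonglongrightarrow> M'.prob {\<omega> \<in> space M'. Q {i \<in> I. \<omega> \<in> V i}}"
  proof (rule occupancy_convergence[OF M U M' V finI])
    fix J assume "J \<subseteq> I"
    \<comment> \<open>Voidness of all balls in \<open>J\<close> splits by pole into avoiding
      \<open>C (-1)\<close> and \<open>C 1\<close>, the two bounded sets to which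
      \<open>void_rate\<close> and \<open>void'\<close> apply.\<close>
    define C where "C \<sigma> = (\<Union>c\<in>{c. (c, \<sigma>) \<in> J}. ball c \<delta>)" for \<sigma> :: real
    define A where "A n = {z. rescale (-1) (s n) z \<in> C (-1) \<or> rescale 1 (s n) z \<in> C 1}" for n
    have finJ: "finite {c. (c, \<sigma>) \<in> J}" for \<sigma>
      using finite_subset[OF \<open>J \<subseteq> I\<close> finI] by (rule finite_subset[rotated, OF finite_imageI[of J fst]]) force
    have C: "bounded (C \<sigma>)" "C \<sigma> \<in> sets borel" for \<sigma>
      unfolding C_def using finJ by (auto intro!: bounded_UN open_UN borel_open)
    have A: "A n \<in> sets borel" for n
      using sets.Un[OF sets_rescale_vimage[OF C(2)[of "-1"] s_pos[of n], of "-1"] sets_rescale_vimage[OF C(2)[of 1] s_pos[of n], of 1]]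
      by (simp add: A_def Collect_disj_eq)
    have "slice_vol (s n) = 1 / real (Suc n)" for n
      unfolding s_def \<gamma>_def by (intro slice_vol_powr) simp
    then have rate: "real (Suc n) * M.prob {\<omega> \<in> space M. Z 0 \<omega> \<in> A n} =
        (LINT z:ellipsoid p a \<inter> A n|lebesgue. f z) / slice_vol (s n)" for n
      using dens[OF A, of 0 n] by simp
    have "(\<lambda>n. real (Suc n) * M.prob {\<omega> \<in> space M. Z 0 \<omega> \<in> A n}) \<longlonglongrightarrow>
      f (axis coord1 (- a coord1)) * measure lebesgue (C (-1) \<inter> paraboloid p a) +
        f (axis coord1 (a coord1)) * measure lebesgue (C 1 \<inter> paraboloid p a)"
      unfolding rate unfolding A_def by (rule void_rate[OF C C s_lim s_pos f cont])
    from void[OF A this]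
    have "(\<lambda>n. M.prob {\<omega> \<in> space M. \<forall>i<K n \<omega>. Z i \<omega> \<notin> A n}) \<longlonglongrightarrow>
        M'.prob {\<omega> \<in> space M'. (\<forall>i. X i \<omega> \<notin> C (-1)) \<and> (\<forall>j. Y j \<omega> \<notin> C 1)}"
      by (simp add: void'[OF C C])
    moreover have J: "\<sigma> = -1 \<or> \<sigma> = 1" if "(c, \<sigma>) \<in> J" for c \<sigma>
      using that \<open>J \<subseteq> I\<close> by (auto simp: I_def)
    have "{\<omega> \<in> space M. \<forall>i<K n \<omega>. Z i \<omega> \<notin> A n} = {\<omega> \<in> space M. \<forall>i\<in>J. \<omega> \<notin> U n i}" for n
    proof (intro Collect_cong conj_cong refl iffI ballI allI impI)
      fix \<omega> i assume *: "\<omega> \<in> space M" "\<forall>i<K n \<omega>. Z i \<omega> \<notin> A n" "i \<in> J"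
      obtain c \<sigma> where i: "i = (c, \<sigma>)" by (cases i)
      have "rescale \<sigma> (s n) (Z k \<omega>) \<notin> ball c \<delta>" if "k < K n \<omega>" for k
        using * that J[of c \<sigma>] unfolding i A_def C_def by blast
      then show "\<omega> \<notin> U n i" by (auto simp: U_def i)
    next
      fix \<omega> k assume *: "\<omega> \<in> space M" "\<forall>i\<in>J. \<omega> \<notin> U n i" "k < K n \<omega>"
      have "rescale \<sigma> (s n) (Z k \<omega>) \<notin> ball c \<delta>" if "(c, \<sigma>) \<in> J" for c \<sigma>
        using *(1,3) bspec[OF *(2) that] unfolding U_def by auto
      then show "Z k \<omega> \<notin> A n" by (auto simp: A_def C_def)
    qed
    moreover have "{\<omega> \<in> space M'. (\<forall>i. X i \<omega> \<notin> C (-1)) \<and> (\<forall>j. Y j \<omega> \<notin> C 1)} = {\<omega> \<in> space M'. \<forall>i\<in>J. \<omega> \<notin> V i}"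
    proof (intro Collect_cong conj_cong refl iffI ballI)
      fix \<omega> i assume *: "\<omega> \<in> space M'" "(\<forall>i. X i \<omega> \<notin> C (-1)) \<and> (\<forall>j. Y j \<omega> \<notin> C 1)" "i \<in> J"
      obtain c \<sigma> where i: "i = (c, \<sigma>)" by (cases i)
      have "(if \<sigma> = -1 then X k \<omega> else Y k \<omega>) \<notin> ball c \<delta>" for k
        using * J[of c \<sigma>] unfolding i C_def by auto
      then show "\<omega> \<notin> V i" by (auto simp: V_def i)
    next
      fix \<omega> assume *: "\<omega> \<in> space M'" "\<forall>i\<in>J. \<omega> \<notin> V i"
      have avoid: "(if \<sigma> = -1 then X k \<omega> else Y k \<omega>) \<notin> ball c \<delta>" if "(c, \<sigma>) \<in> J" for c \<sigma> k
        using *(1) bspec[OF *(2) that] unfolding V_def by auto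
      show "(\<forall>i. X i \<omega> \<notin> C (-1)) \<and> (\<forall>j. Y j \<omega> \<notin> C 1)"
        using avoid[of _ "-1"] avoid[of _ 1] unfolding C_def by auto
    qed
    ultimately show "(\<lambda>n. M.prob {\<omega> \<in> space M. \<forall>i\<in>J. \<omega> \<notin> U n i}) \<longlonglongrightarrow>
       M'.prob {\<omega> \<in> space M'. \<forall>i\<in>J. \<omega> \<notin> V i}" by simp
  qed
  have pre: "\<forall>\<^sub>F n in sequentially. M.prob {\<omega> \<in> space M. D n \<omega> \<le> t} \<le> M.prob {\<omega> \<in> space M. Q {i \<in> I. \<omega> \<in> U n i}} \<and>
      M.prob {\<omega> \<in> space M. Q {i \<in> I. \<omega> \<in> U n i}} \<le> M.prob {\<omega> \<in> space M. D n \<omega> \<le> t + \<epsilon>}"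
  proof -
    \<comment> \<open>An empty sample has \<open>pdiam\<close> equal to \<open>0\<close> by
      convention, hence defect \<open>2 * a coord1\<close>. For large \<open>n\<close> this exceeds
      \<open>s n * t\<close>, so the event \<open>D n \<omega> \<le> t\<close> presupposes a sample
      point.\<close>
    have "(\<lambda>n. s n * t) \<longlonglongrightarrow> 0 * t" by (intro tendsto_intros s_lim)
    then have "\<forall>\<^sub>F n in sequentially. s n * t < 2 * a coord1" using a_pos[of coord1] by (intro order_tendstoD) auto
    then show ?thesis using order_tendstoD(2)[OF s_lim W(3)]
    proof eventually_elim
      case (elim n)
      have "M.prob {\<omega> \<in> space M. D n \<omega> \<le> t} \<le> M.prob {\<omega> \<in> space M. Q {i \<in> I. \<omega> \<in> U n i}}"
      \<comment> \<open>The inclusion is only almost sure: \<open>W(4)\<close> needs points of the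
        ellipsoid, and the sample may leave it on a null set.\<close>
      proof (rule M.finite_measure_mono_AE[OF _ QU_sets])
        show "AE \<omega> in M. \<omega> \<in> {\<omega> \<in> space M. D n \<omega> \<le> t} \<longrightarrow> \<omega> \<in> {\<omega> \<in> space M. Q {i \<in> I. \<omega> \<in> U n i}}"
          using Z_in
        proof eventually_elim
          case (elim \<omega>)
          show ?case
          proof
            assume "\<omega> \<in> {\<omega> \<in> space M. D n \<omega> \<le> t}"
            then have \<omega>: "\<omega> \<in> space M" and le: "2 * a coord1 - pdiam p (K n \<omega>) (\<lambda>i. Z i \<omega>) \<le> s n * t"
              by (auto simp: D_le)
            have "K n \<omega> \<noteq> 0"
            proof
              assume "K n \<omega> = 0"
              then show False using le \<open>s n * t < 2 * a coord1\<close> by (simp add: pdiam_def)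
            qed
            then obtain i j where ij: "i < K n \<omega>" "j < K n \<omega>"
              "pdiam p (K n \<omega>) (\<lambda>i. Z i \<omega>) = pnorm_on UNIV p (Z i \<omega> - Z j \<omega>)"
              using pdiam_attained[of "K n \<omega>" p "\<lambda>i. Z i \<omega>"] by auto
            have "\<exists>(c, c')\<in>W. rescale (-1) (s n) (Z i \<omega>) \<in> ball c \<delta> \<and> rescale 1 (s n) (Z j \<omega>) \<in> ball c' \<delta> \<or>
                 rescale (-1) (s n) (Z j \<omega>) \<in> ball c \<delta> \<and> rescale 1 (s n) (Z i \<omega>) \<in> ball c' \<delta>"
              using elim le ij(3) \<open>s n < s0\<close> by (intro W(4) s_pos) auto
            then have "\<exists>(c, c')\<in>W. \<omega> \<in> U n (c, -1) \<and> \<omega> \<in> U n (c', 1)"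
              using \<omega> ij unfolding U_def by fastforce
            then show "\<omega> \<in> {\<omega> \<in> space M. Q {i \<in> I. \<omega> \<in> U n i}}" using \<omega> by (simp add: Q_U)
          qed
        qed
      qed
      moreover have "M.prob {\<omega> \<in> space M. Q {i \<in> I. \<omega> \<in> U n i}} \<le> M.prob {\<omega> \<in> space M. D n \<omega> \<le> t + \<epsilon>}"
      proof (rule M.finite_measure_mono)
        show "{\<omega> \<in> space M. D n \<omega> \<le> t + \<epsilon>} \<in> sets M" by measurable
        show "{\<omega> \<in> space M. Q {i \<in> I. \<omega> \<in> U n i}} \<subseteq> {\<omega> \<in> space M. D n \<omega> \<le> t + \<epsilon>}"
        proof
          fix \<omega> assume "\<omega> \<in> {\<omega> \<in> space M. Q {i \<in> I. \<omega> \<in> U n i}}"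
          then obtain c c' i j where \<omega>: "\<omega> \<in> space M" and c: "(c, c') \<in> W" and ij: "i < K n \<omega>" "j < K n \<omega>"
            "rescale (-1) (s n) (Z i \<omega>) \<in> ball c \<delta>" "rescale 1 (s n) (Z j \<omega>) \<in> ball c' \<delta>"
            unfolding Q_U by (auto simp: U_def)
          have "2 * a coord1 - pnorm_on UNIV p (Z i \<omega> - Z j \<omega>) \<le> s n * (t + \<epsilon>)"
            using c ij \<open>s n < s0\<close> by (intro W(5)[of "s n" c c'] s_pos) auto
          then show "\<omega> \<in> {\<omega> \<in> space M. D n \<omega> \<le> t + \<epsilon>}"
            using pdiam_ge[OF ij(1,2), of p "\<lambda>i. Z i \<omega>"] \<omega> by (simp add: D_le)
        qed
      qed
      ultimately show ?case ..
    qed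
  qed
  have lim_upper: "M'.prob {\<omega> \<in> space M'. T \<omega> \<le> t} \<le> M'.prob {\<omega> \<in> space M'. Q {i \<in> I. \<omega> \<in> V i}}"
  proof (rule M'.finite_measure_mono_AE[OF _ QV_sets])
    show "AE \<omega> in M'. \<omega> \<in> {\<omega> \<in> space M'. T \<omega> \<le> t} \<longrightarrow> \<omega> \<in> {\<omega> \<in> space M'. Q {i \<in> I. \<omega> \<in> V i}}"
      using XY_in T_le[of t]
    proof eventually_elim
      case (elim \<omega>)
      show ?case
      proof
        assume "\<omega> \<in> {\<omega> \<in> space M'. T \<omega> \<le> t}"
        then obtain i j where \<omega>: "\<omega> \<in> space M'" and "limit_value p a (X i \<omega>) (Y j \<omega>) \<le> t" using elim by auto
        then have "\<exists>(c, c')\<in>W. X i \<omega> \<in> ball c \<delta> \<and> Y j \<omega> \<in> ball c' \<delta>" using elim by (intro W(6)) auto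
        then have "\<exists>(c, c')\<in>W. \<omega> \<in> V (c, -1) \<and> \<omega> \<in> V (c', 1)"
          using \<omega> unfolding V_def by fastforce
        then show "\<omega> \<in> {\<omega> \<in> space M'. Q {i \<in> I. \<omega> \<in> V i}}" using \<omega> by (simp add: Q_V)
      qed
    qed
  qed
  have lim_lower: "M'.prob {\<omega> \<in> space M'. Q {i \<in> I. \<omega> \<in> V i}} \<le> M'.prob {\<omega> \<in> space M'. T \<omega> \<le> t + \<epsilon>}"
  proof (rule M'.finite_measure_mono_AE)
    show "{\<omega> \<in> space M'. T \<omega> \<le> t + \<epsilon>} \<in> sets M'" by measurable
    show "AE \<omega> in M'. \<omega> \<in> {\<omega> \<in> space M'. Q {i \<in> I. \<omega> \<in> V i}} \<longrightarrow> \<omega> \<in> {\<omega> \<in> space M'. T \<omega> \<le> t + \<epsilon>}"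
      using T_le[of "t + \<epsilon>"]
    proof eventually_elim
      case (elim \<omega>)
      show ?case
      proof
        assume "\<omega> \<in> {\<omega> \<in> space M'. Q {i \<in> I. \<omega> \<in> V i}}"
        then obtain c c' i j where \<omega>: "\<omega> \<in> space M'" and c: "(c, c') \<in> W"
          and ij: "X i \<omega> \<in> ball c \<delta>" "Y j \<omega> \<in> ball c' \<delta>"
          unfolding Q_V by (auto simp: V_def)
        then have "limit_value p a (X i \<omega>) (Y j \<omega>) \<le> t + \<epsilon>" by (intro W(7)[OF c])
        then show "\<omega> \<in> {\<omega> \<in> space M'. T \<omega> \<le> t + \<epsilon>}" using elim \<omega> by blast
      qed
    qed
  qed
  show "\<exists>b b'. b \<longlonglongrightarrow> b' \<and>
      (\<forall>\<^sub>F n in sequentially. M.prob {\<omega> \<in> space M. real (Suc n) powr \<gamma> * (2 * a coord1 - pdiam p (K n \<omega>) (\<lambda>i. Z i \<omega>)) \<le> t} \<le> b n \<and>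
         b n \<le> M.prob {\<omega> \<in> space M. real (Suc n) powr \<gamma> * (2 * a coord1 - pdiam p (K n \<omega>) (\<lambda>i. Z i \<omega>)) \<le> t + \<epsilon>}) \<and>
      M'.prob {\<omega> \<in> space M'. T \<omega> \<le> t} \<le> b' \<and> b' \<le> M'.prob {\<omega> \<in> space M'. T \<omega> \<le> t + \<epsilon>}"
    unfolding D_def[symmetric] using conv pre lim_upper lim_lower by blast
qed

end

section \<open>Poisson counts, intensity measures and the index shift\<close>

lemma (in prob_space) poisson_count:
  assumes dist: "distr M (count_space UNIV) N = measure_pmf (poisson_pmf r)" and r: "0 < r"
  shows "N \<in> M \<rightarrow>\<^sub>M count_space UNIV"
    and "prob {\<omega> \<in> space M. N \<omega> = k} = r ^ k / fact k * exp (- r)"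
proof -
  \<comment> \<open>A non-measurable fibre would have measure \<open>0\<close>, but every value has positive probability.\<close>
  have "N -` {k} \<inter> space M \<in> sets M" for k
  proof (rule ccontr)
    assume "N -` {k} \<inter> space M \<notin> sets M"
    then have "emeasure M (N -` {k} \<inter> space M) = 0" by (rule emeasure_notin_sets)
    then have "emeasure (distr M (count_space UNIV) N) {k} = 0"
      by (simp add: distr_def emeasure_measure_of_conv)
    then show False using r by (simp add: dist emeasure_pmf_single)
  qed
  then show N: "N \<in> M \<rightarrow>\<^sub>M count_space UNIV"
    by (simp add: measurable_count_space_eq2_countable)
  have "N -` {k} \<inter> space M = {\<omega> \<in> space M. N \<omega> = k}" by auto
  then have "prob {\<omega> \<in> space M. N \<omega> = k} = measure (distr M (count_space UNIV) N) {k}"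
    using measure_distr[OF N, of "{k}"] by simp
  also have "\<dots> = r ^ k / fact k * exp (- r)"
    using r by (simp add: dist measure_pmf_single)
  finally show "prob {\<omega> \<in> space M. N \<omega> = k} = r ^ k / fact k * exp (- r)" .
qed

lemma scaled_lebesgue_on:
  fixes S A :: "(real ^ 'n::finite) set"
  assumes "0 \<le> c" "S \<in> sets borel" "A \<in> sets borel"
  shows "emeasure (scaled_lebesgue_on c S) A = ennreal c * emeasure lborel (A \<inter> S)"
    and "measure (scaled_lebesgue_on c S) A = c * measure lebesgue (A \<inter> S)"
proof -
  have "emeasure (scaled_lebesgue_on c S) A = (\<integral>\<^sup>+ z. (ennreal c * indicator S z) * indicator A z \<partial>lborel)"
    unfolding scaled_lebesgue_on_def using assms by (intro emeasure_density) auto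
  also have "\<dots> = (\<integral>\<^sup>+ z. ennreal c * indicator (A \<inter> S) z \<partial>lborel)"
    by (intro nn_integral_cong) (auto simp: indicator_def)
  also have "\<dots> = ennreal c * emeasure lborel (A \<inter> S)"
    using assms by (subst nn_integral_cmult_indicator) auto
  finally show 1: "emeasure (scaled_lebesgue_on c S) A = ennreal c * emeasure lborel (A \<inter> S)" .
  have "measure lebesgue (A \<inter> S) = measure lborel (A \<inter> S)"
    using assms by (intro measure_completion) auto
  then show "measure (scaled_lebesgue_on c S) A = c * measure lebesgue (A \<inter> S)"
    using assms by (simp add: measure_def 1 enn2real_mult)
qed

lemma sets_scaled_lebesgue_on [simp]: "sets (scaled_lebesgue_on c S) = sets borel"
  by (simp add: scaled_lebesgue_on_def)

text \<open>Nothing is assumed about the Poisson variable with index \<open>0\<close>, so the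
  argument runs along \<open>Suc n\<close>; a limit does not see the shift.\<close>

lemma weak_conv_m_offset:
  assumes "weak_conv_m (\<lambda>n. \<mu> (Suc n)) \<nu>"
  shows "weak_conv_m \<mu> \<nu>"
  using assms unfolding weak_conv_m_def weak_conv_def by (auto intro: LIMSEQ_imp_Suc)

theorem theorem5:
  fixes p p\<^sub>l p\<^sub>r :: real
    and a :: "'n::{finite,linorder} \<Rightarrow> real"
    and f :: "real ^ 'n::{finite,linorder} \<Rightarrow> real"
    and M :: "'w measure" and Z :: "nat \<Rightarrow> 'w \<Rightarrow> real ^ 'n::{finite,linorder}" and N :: "nat \<Rightarrow> 'w \<Rightarrow> nat"
    and M' :: "'v measure" and X Y :: "nat \<Rightarrow> 'v \<Rightarrow> real ^ 'n::{finite,linorder}"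
  defines "E \<equiv> ellipsoid p a"
    and "\<mu> \<equiv> scaled_lebesgue_on p\<^sub>l (paraboloid p a)"
    and "\<nu> \<equiv> scaled_lebesgue_on p\<^sub>r (paraboloid p a)"
    and "T \<equiv> \<lambda>\<omega>. INF (i, j)\<in>UNIV. limit_value p a (X i \<omega>) (Y j \<omega>)"
  assumes dim: "CARD('n) \<ge> 2"
    and p: "1 \<le> p"
    and a_pos: "\<And>k. a k > 0"
    and a_antimono: "antimono a"
    and a_first: "\<And>k. k \<noteq> coord1 \<Longrightarrow> a k < a coord1"
    and f_nonneg: "\<And>z. z \<in> E \<Longrightarrow> 0 \<le> f z"
    and f_integrable: "set_integrable lebesgue E f"
    and f_integral: "(LINT z:E|lebesgue. f z) = 1"
    and cont_l: "continuous (at (axis coord1 (- a coord1)) within E) f"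
    and cont_r: "continuous (at (axis coord1 (a coord1)) within E) f"
    and p_l: "p\<^sub>l = f (axis coord1 (- a coord1))" "p\<^sub>l > 0"
    and p_r: "p\<^sub>r = f (axis coord1 (a coord1))" "p\<^sub>r > 0"
    and M: "prob_space M"
    and Z_indep: "prob_space.indep_vars M (\<lambda>_. borel) Z UNIV"
    and Z_density: "\<And>i B. B \<in> sets borel \<Longrightarrow>
          \<P>(\<omega> in M. Z i \<omega> \<in> B) = (LINT z:E \<inter> B|lebesgue. f z)"
    and N_poisson: "\<And>n. n \<ge> 1 \<Longrightarrow>
          distr M (count_space UNIV) (N n) = measure_pmf (poisson_pmf (real n))"
    and N_indep: "\<And>n. n \<ge> 1 \<Longrightarrow>
          prob_space.indep_set M
            (sets (vimage_algebra (space M) (N n) (count_space UNIV)))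
            (sets (vimage_algebra (space M) (\<lambda>\<omega> i. Z i \<omega>) (PiM UNIV (\<lambda>_. borel))))"
    and M': "prob_space M'"
    and X: "prob_space.poisson_process M' \<mu> X"
    and Y: "prob_space.poisson_process M' \<nu> Y"
    and XY_indep: "prob_space.indep_processes M' \<mu> X \<nu> Y"
  shows
    \<comment> \<open>the infimum defining \<open>T\<close> is almost surely a minimum\<close>
    "(AE \<omega> in M'. \<exists>i j. \<forall>i' j'.
        limit_value p a (X i \<omega>) (Y j \<omega>) \<le> limit_value p a (X i' \<omega>) (Y j' \<omega>)) \<and>
     T \<in> borel_measurable M' \<and>
     weak_conv_m
       (\<lambda>n. distr M borel (\<lambda>\<omega>. real n powr (p / (real CARD('n) + p - 1)) *
              (2 * a coord1 - pdiam p (N n \<omega>) (\<lambda>i. Z i \<omega>))))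
       (distr M' borel T) \<and>
     weak_conv_m
       (\<lambda>n. distr M borel (\<lambda>\<omega>. real n powr (p / (real CARD('n) + p - 1)) *
              (2 * a coord1 - pdiam p n (\<lambda>i. Z i \<omega>))))
       (distr M' borel T)"
proof -
  interpret elliptic_ball p a by unfold_locales (fact p a_pos a_first)+
  interpret M: prob_space M by fact
  interpret M': prob_space M' by fact
  note defs = E_def \<mu>_def \<nu>_def
  let ?P = "paraboloid p a"
  have P [measurable]: "?P \<in> sets borel" using closed_paraboloid by auto
  have sets [simp]: "sets \<mu> = sets borel" "sets \<nu> = sets borel" by (simp_all add: defs)
  have Xm [measurable]: "X i \<in> borel_measurable M'" and Ym [measurable]: "Y i \<in> borel_measurable M'" for i
    using X Y measurable_cong_sets[OF refl sets(1), of M'] measurable_cong_sets[OF refl sets(2), of M']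
    by (auto simp: M'.poisson_process_def)
  have Zm [measurable]: "Z i \<in> borel_measurable M" for i
    using Z_indep by (auto simp: M.indep_vars_def)
  \<comment> \<open>The intensities are infinite on the whole paraboloid but finite on bounded sets,
    which is where void probabilities are evaluated.\<close>
  have \<mu>_fin: "emeasure \<mu> A \<noteq> \<infinity>" "emeasure \<nu> A \<noteq> \<infinity>" if "bounded A" "A \<in> sets borel" for A
  proof -
    have "emeasure lborel (A \<inter> ?P) < \<infinity>"
      using that by (intro emeasure_bounded_finite) (auto intro: bounded_subset)
    then show "emeasure \<mu> A \<noteq> \<infinity>" "emeasure \<nu> A \<noteq> \<infinity>"
      using that p_l(2) p_r(2) by (simp_all add: defs scaled_lebesgue_on ennreal_mult_eq_top_iff)
  qed
  \<comment> \<open>The complement of the paraboloid has intensity \<open>0\<close>.\<close>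
  have XY_in: "AE \<omega> in M'. \<forall>i. X i \<omega> \<in> ?P" "AE \<omega> in M'. \<forall>j. Y j \<omega> \<in> ?P"
    using M'.poisson_process_AE_not_in[OF X, of "- ?P"] M'.poisson_process_AE_not_in[OF Y, of "- ?P"]
      p_l(2) p_r(2) by (auto simp: defs scaled_lebesgue_on)
  have cap: "bounded {z \<in> ?P. z $ coord1 \<le> R}" "{z \<in> ?P. z $ coord1 \<le> R} \<in> sets borel" for R
    using compact_paraboloid_cap[of R] by (auto intro: compact_imp_bounded borel_compact)
  have "AE \<omega> in M'. \<forall>R::nat. finite {i. X i \<omega> \<in> {z \<in> ?P. z $ coord1 \<le> real R}}"
    unfolding AE_all_countable
    by (intro allI M'.poisson_process_AE_finite[OF X]) (simp_all only: sets cap \<mu>_fin[OF cap] not_False_eq_True)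
  moreover have "AE \<omega> in M'. \<forall>R::nat. finite {j. Y j \<omega> \<in> {z \<in> ?P. z $ coord1 \<le> real R}}"
    unfolding AE_all_countable
    by (intro allI M'.poisson_process_AE_finite[OF Y]) (simp_all only: sets cap \<mu>_fin[OF cap] not_False_eq_True)
  ultimately have attained: "AE \<omega> in M'. \<exists>i j. \<forall>i' j'.
        limit_value p a (X i \<omega>) (Y j \<omega>) \<le> limit_value p a (X i' \<omega>) (Y j' \<omega>)"
    using XY_in
  proof eventually_elim
    case (elim \<omega>)
    then show ?case by (intro minimum_attained) auto
  qed
  have T: "T \<in> borel_measurable M'"
  proof -
    have [measurable]: "(\<lambda>z :: (real ^ 'n::{finite,linorder}) \<times> (real ^ 'n::{finite,linorder}).
        limit_value p a (fst z) (snd z)) \<in> borel_measurable (borel \<Otimes>\<^sub>M borel)"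
      using borel_measurable_continuous_onI[OF continuous_limit_value[of UNIV]]
      by (simp add: case_prod_unfold borel_prod)
    have "(\<lambda>\<omega>. limit_value p a (X i \<omega>) (Y j \<omega>)) \<in> borel_measurable M'" for i j
      using measurable_compose[of "\<lambda>\<omega>. (X i \<omega>, Y j \<omega>)" M' "borel \<Otimes>\<^sub>M borel" "\<lambda>z. limit_value p a (fst z) (snd z)" borel]
      by simp
    then show ?thesis unfolding T_def by (intro borel_measurable_cINF_real) (auto simp: case_prod_unfold)
  qed
  have void': "M'.prob {\<omega> \<in> space M'. (\<forall>i. X i \<omega> \<notin> A) \<and> (\<forall>j. Y j \<omega> \<notin> B)} =
      exp (- (f (axis coord1 (- a coord1)) * measure lebesgue (A \<inter> ?P) +
              f (axis coord1 (a coord1)) * measure lebesgue (B \<inter> ?P)))"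
    if "bounded A" "A \<in> sets borel" "bounded B" "B \<in> sets borel" for A B
    using M'.poisson_processes_void[OF X Y XY_indep, of A B] that \<mu>_fin p_l p_r
    by (simp add: defs scaled_lebesgue_on)
  have prob_Z: "M.prob {\<omega> \<in> space M. Z i \<omega> \<in> B} = M.prob {\<omega> \<in> space M. Z 0 \<omega> \<in> B}"
    if "B \<in> sets borel" for i B
    using Z_density[OF that, of i] Z_density[OF that, of 0] by simp
  \<comment> \<open>One statement for both samples: \<open>K n\<close> will be
    \<open>N (Suc n)\<close> and the constant \<open>Suc n\<close>.\<close>
  have conv: "weak_conv_m
       (\<lambda>n. distr M borel (\<lambda>\<omega>. real (Suc n) powr (p / (real CARD('n) + p - 1)) *
              (2 * a coord1 - pdiam p (K n \<omega>) (\<lambda>i. Z i \<omega>))))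
       (distr M' borel T)"
    if "\<And>n. K n \<in> M \<rightarrow>\<^sub>M count_space UNIV"
      and "\<And>A c. (\<And>n. A n \<in> sets borel) \<Longrightarrow>
        (\<lambda>n. real (Suc n) * M.prob {\<omega> \<in> space M. Z 0 \<omega> \<in> A n}) \<longlonglongrightarrow> c \<Longrightarrow>
        (\<lambda>n. M.prob {\<omega> \<in> space M. \<forall>i<K n \<omega>. Z i \<omega> \<notin> A n}) \<longlonglongrightarrow> exp (- c)" for K
    unfolding T_def
    by (rule diameter_weak_limit[OF M Zm that(1) Z_density[unfolded E_def] f_integrable[unfolded E_def]
        cont_l[unfolded E_def] cont_r[unfolded E_def] that(2) M' Xm Ym void' XY_in attained T[unfolded T_def]])
  have "weak_conv_m
       (\<lambda>n. distr M borel (\<lambda>\<omega>. real n powr (p / (real CARD('n) + p - 1)) *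
              (2 * a coord1 - pdiam p (N n \<omega>) (\<lambda>i. Z i \<omega>))))
       (distr M' borel T)"
  proof (rule weak_conv_m_offset, rule conv)
    note N = M.poisson_count[OF N_poisson]
    show Nm: "N (Suc n) \<in> M \<rightarrow>\<^sub>M count_space UNIV" for n by (rule N(1)) auto
    fix A :: "nat \<Rightarrow> (real ^ 'n::{finite,linorder}) set" and c
    assume A: "\<And>n. A n \<in> sets borel"
      and lim: "(\<lambda>n. real (Suc n) * M.prob {\<omega> \<in> space M. Z 0 \<omega> \<in> A n}) \<longlonglongrightarrow> c"
    have "M.prob {\<omega> \<in> space M. \<forall>i<N (Suc n) \<omega>. Z i \<omega> \<notin> A n} =
        exp (- (real (Suc n) * M.prob {\<omega> \<in> space M. Z 0 \<omega> \<in> A n}))" for n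
      by (rule M.poisson_mixture_void[OF Z_indep A prob_Z[OF A] Nm N(2) N_indep]) auto
    then show "(\<lambda>n. M.prob {\<omega> \<in> space M. \<forall>i<N (Suc n) \<omega>. Z i \<omega> \<notin> A n}) \<longlonglongrightarrow> exp (- c)"
      using lim by (simp only:) (intro tendsto_intros)
  qed
  moreover have "weak_conv_m
       (\<lambda>n. distr M borel (\<lambda>\<omega>. real n powr (p / (real CARD('n) + p - 1)) *
              (2 * a coord1 - pdiam p n (\<lambda>i. Z i \<omega>))))
       (distr M' borel T)"
  proof (rule weak_conv_m_offset, rule conv)
    fix A :: "nat \<Rightarrow> (real ^ 'n::{finite,linorder}) set" and c
    assume A: "\<And>n. A n \<in> sets borel"
      and lim: "(\<lambda>n. real (Suc n) * M.prob {\<omega> \<in> space M. Z 0 \<omega> \<in> A n}) \<longlonglongrightarrow> c"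
    show "(\<lambda>n. M.prob {\<omega> \<in> space M. \<forall>i<Suc n. Z i \<omega> \<notin> A n}) \<longlonglongrightarrow> exp (- c)"
      using power_one_minus_tendsto_exp[OF lim] by (simp only: M.iid_void[OF Z_indep A prob_Z[OF A]])
  qed auto
  ultimately show ?thesis using attained T by blast
qed

end
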